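(* Let $k_1,k_2>0$, put $\omega=\sqrt{2k_1}$, and define $$\tau^*=\frac1\omega\Bigl(\operatorname{atan2}\bigl(-k_2\omega^3,\;k_1^2+\omega^2(k_2^2-k_1)\bigr)+\pi\Bigr),$$ where $\operatorname{atan2}(b,a)\in(-\pi,\pi]$ denotes the argument of the complex number $a+\mathrm{i}b$. If $0\le\tau<\tau^*$, then for every $n\ge2$ and every connected undirected graph on $n$ vertices, the $n$ agents $\ddot x_i(t)=u_i(t)$ communicating over that graph under the protocol $$u_i(t)=k_1\Bigl[\sum_{j\in\mathcal N_i}\frac{x_j(t-\tau)}{\delta_i}-x_i(t)\Bigr]+k_2\Bigl[\sum_{j\in\mathcal N_i}\frac{\dot x_j(t-\tau)}{\delta_i}-\dot x_i(t)\Bigr]$$ reach consensus.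
   Context: $\mathcal N_i$ is the set of neighbours of agent $i$ in the (simple, undirected) communication graph and $\delta_i=|\mathcal N_i|$; the delay $\tau$ is constant and uniform. The agents reach consensus if, for every initial history, $x_i(t)-x_j(t)\to 0$ and $\dot x_i(t)-\dot x_j(t)\to0$ as $t\to\infty$ for all $i,j$; equivalently, the disagreement factors $s^2+(k_2s+k_1)(1-\lambda e^{-\tau s})$, for all eigenvalues $\lambda\neq1$ of the weighted adjacency matrix $\mathbf C=\boldsymbol\Delta^{-1}\mathbf A_\Gamma$ ($\mathbf A_\Gamma$ the adjacency matrix, $\boldsymbol\Delta$ the diagonal degree matrix), are all stable (all roots have negative real part). *)

theory Defs
  imports "HOL-Analysis.Analysis" "Graph_Theory.Graph_Theory"
begin

definition atan2 :: "real \<Rightarrow> real \<Rightarrow> real" where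
  "atan2 b a = Arg (Complex a b)"

definition critical_delay :: "real \<Rightarrow> real \<Rightarrow> real" where
  "critical_delay k1 k2 =
     (let \<omega> = sqrt (2 * k1)
      in 1 / \<omega> * (atan2 (- k2 * \<omega>^3) (k1\<^sup>2 + \<omega>\<^sup>2 * (k2\<^sup>2 - k1)) + pi))"

text \<open>An undirected simple graph is a symmetric loopfree digraph without parallel arcs
  (locale \<^locale>\<open>graph\<close>), so the out-neighbours are exactly the neighbours.\<close>

definition neighbours :: "('v, 'e) pre_digraph \<Rightarrow> 'v \<Rightarrow> 'v set" where
  "neighbours G i = {j. i \<rightarrow>\<^bsub>G\<^esub> j}"

definition protocol ::
  "('v, 'e) pre_digraph \<Rightarrow> real \<Rightarrow> real \<Rightarrow> real \<Rightarrow>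
   ('v \<Rightarrow> real \<Rightarrow> real) \<Rightarrow> ('v \<Rightarrow> real \<Rightarrow> real) \<Rightarrow> 'v \<Rightarrow> real \<Rightarrow> real" where
  "protocol G k1 k2 \<tau> x v i t =
     k1 * ((\<Sum>j\<in>neighbours G i. x j (t - \<tau>) / real (card (neighbours G i))) - x i t) +
     k2 * ((\<Sum>j\<in>neighbours G i. v j (t - \<tau>) / real (card (neighbours G i))) - v i t)"

text \<open>Here \<open>v i\<close> is the velocity of agent \<open>i\<close>. The restriction of \<open>x\<close> to \<open>[-\<tau>, 0]\<close> is
  the initial history, an arbitrary continuously differentiable function. The equation of motion
  starts at time \<open>0\<close>, so there only the right-hand derivative of the velocity is constrained:
  the history need not satisfy the delay equation.\<close>

definition trajectory ::
  "('v, 'e) pre_digraph \<Rightarrow> real \<Rightarrow> real \<Rightarrow> real \<Rightarrow>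
   ('v \<Rightarrow> real \<Rightarrow> real) \<Rightarrow> ('v \<Rightarrow> real \<Rightarrow> real) \<Rightarrow> bool" where
  "trajectory G k1 k2 \<tau> x v \<longleftrightarrow>
     (\<forall>i\<in>verts G.
        (\<forall>t\<ge>-\<tau>. (x i has_real_derivative v i t) (at t within {-\<tau>..})) \<and>
        continuous_on {-\<tau>..} (v i) \<and>
        (\<forall>t\<ge>0. (v i has_real_derivative protocol G k1 k2 \<tau> x v i t) (at t within {0..})))"

definition reach_consensus ::
  "('v, 'e) pre_digraph \<Rightarrow> real \<Rightarrow> real \<Rightarrow> real \<Rightarrow> bool" where
  "reach_consensus G k1 k2 \<tau> \<longleftrightarrow>
     (\<forall>x v. trajectory G k1 k2 \<tau> x v \<longrightarrow>
        (\<forall>i\<in>verts G. \<forall>j\<in>verts G.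
           ((\<lambda>t. x i t - x j t) \<longlongrightarrow> 0) at_top \<and>
           ((\<lambda>t. v i t - v j t) \<longlongrightarrow> 0) at_top))"

end

(*
  Pairing the positions with the eigenfunctions of the neighbour average (a self-adjoint operator for
  the degree-weighted pairing) splits the disagreement into scalar delay equations, one for each
  eigenvalue c in [-1, 1).  A root iy of s^2 + (k2 s + k1)(1 - c exp(-tau s)) forces y^2 <= 2 k1, and
  comparing the phases at y and at sqrt(2 k1) excludes such roots for delays below the critical one;
  by Hurwitz' theorem no root crosses into the right half-plane while c is moved from 0 to its value.
  Stability is then deduced from a Liouville argument instead of Laplace inversion.  A solution on the
  whole real line with norm at most exp(sigma t) has one-sided Laplace transforms that continue each
  other across the root-free line Re s = sigma to an entire function bounded by 1 / |Re s - sigma|,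
  hence to 0.  So the solution vanishes, by compactness solutions with this bound on a long
  window are halved at its centre, and no nonnegative exponential rate can be optimal.
*)
theory Submission
  imports Defs "HOL-Complex_Analysis.Complex_Analysis" "HOL-Computational_Algebra.Fundamental_Theorem_Algebra"
begin

section \<open>A Liouville theorem for the delay equation\<close>

text \<open>The number \<open>critical_delay\<close> is the smallest delay at which the factor with
  c = -1 has the root i \<omega>, where \<omega> = sqrt(2 k1): such a root determines the cosine and
  sine of \<tau>\<omega>, and the resulting angle lies in (0, pi). Bipartite graphs have the
  eigenvalue -1, so a bound valid for all graphs must include it. The value c = 1 has to be kept
  out, since s = 0 is then a root; it belongs to the constants, which differences between agents do
  not see. The obstacle on the analytic side is that the position of the roots says nothing directly
  about solutions: in general there are infinitely many roots, and a given history is not a sum of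
  exponentials. Complete solutions avoid the question, because they carry no free history. The
  infimum of the admissible rates need not be attained; the constants 1/2, 4/3 and 2/3 in the decay
  argument leave room for a rate slightly above it.\<close>

lemma entire_bounded_off_line_eq_0:
  fixes F :: "complex \<Rightarrow> complex"
  assumes hol: "F holomorphic_on UNIV"
    and bnd: "\<And>s. Re s \<noteq> \<sigma> \<Longrightarrow> norm (F s) \<le> 1 / \<bar>Re s - \<sigma>\<bar>"
  shows "F p = 0"
proof -
  define c where "c = complex_of_real \<sigma>"
  have cont: "continuous_on UNIV F"
    using hol holomorphic_on_imp_continuous_on by blast
  \<comment> \<open>On the circle of radius \<open>R\<close> about \<open>c\<close> the factor \<open>1 + (s - c)\<^sup>2 / R\<^sup>2\<close> has modulus
    \<open>2 \<bar>Re (s - c)\<bar> / R\<close>, which cancels the singular bound on \<open>F\<close>.\<close>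
  have key: "norm (F p * (1 + (p - c)^2 / of_real (R^2))) \<le> 2 / R"
    if R: "R > norm (p - c)" for R :: real
  proof -
    have R0: "R > 0" using R norm_ge_zero[of "p - c"] by linarith
    define g where "g s = F s * (1 + (s - c)^2 / of_real (R^2))" for s
    have holg: "g holomorphic_on UNIV"
      unfolding g_def using hol by (intro holomorphic_intros) (use R0 in auto)
    have sphere: "norm (g s) \<le> 2 / R" if s: "s \<in> frontier (ball c R)" for s
    proof -
      have ns: "norm (s - c) = R" using s R0 by (simp add: dist_norm norm_minus_commute)
      define d where "d = s - c"
      have dd: "of_real (R^2) = d * cnj d"
        using ns complex_norm_square[of d] by (simp add: d_def)
      have dnz: "d \<noteq> 0" using ns R0 d_def by auto
      have "1 + d^2 / of_real (R^2) = (cnj d + d) / cnj d"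
        unfolding dd using dnz by (simp add: field_simps power2_eq_square)
      also have "\<dots> = of_real (2 * Re d) / cnj d"
        using complex_add_cnj[of d] by (simp add: add.commute)
      finally have e: "1 + d^2 / of_real (R^2) = of_real (2 * Re d) / cnj d" .
      have "norm d = R" using ns d_def by simp
      then have nd: "norm (1 + d^2 / of_real (R^2)) = 2 * \<bar>Re d\<bar> / R"
        unfolding e norm_divide complex_mod_cnj norm_of_real by (simp add: abs_mult)
      show ?thesis
      \<comment> \<open>At the two points where the circle meets the line no bound on
        \<open>F\<close> is available, but there the factor vanishes.\<close>
      proof (cases "Re s = \<sigma>")
        case True
        then have "norm (1 + d^2 / of_real (R^2)) = 0"
          using nd by (simp add: d_def c_def)
        then show ?thesis unfolding g_def d_def[symmetric] norm_mult using R0 by (simp del: of_real_power)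
      next
        case False
        have rd: "Re d = Re s - \<sigma>" by (simp add: d_def c_def)
        have "norm (g s) = norm (F s) * (2 * \<bar>Re d\<bar> / R)"
          unfolding g_def d_def[symmetric] norm_mult nd ..
        also have "\<dots> \<le> 1 / \<bar>Re d\<bar> * (2 * \<bar>Re d\<bar> / R)"
          using bnd[OF False] R0 by (intro mult_right_mono) (auto simp: rd)
        also have "\<dots> = 2 / R" using False rd by simp
        finally show ?thesis .
      qed
    qed
    have "norm (g p) \<le> 2 / R"
    proof (rule maximum_modulus_frontier[of g "ball c R"])
      show "g holomorphic_on interior (ball c R)" using holg holomorphic_on_subset by blast
      show "continuous_on (closure (ball c R)) g"
        using holg holomorphic_on_imp_continuous_on continuous_on_subset by blast
    qed (use sphere R in \<open>auto simp: dist_norm norm_minus_commute\<close>)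
    then show ?thesis by (simp add: g_def)
  qed
  have l: "((\<lambda>R. norm (F p * (1 + (p - c)^2 / of_real (R^2)))) \<longlongrightarrow> norm (F p * (1 + 0))) at_top"
  proof (intro tendsto_intros)
    have "((\<lambda>R. norm ((p - c)^2) / R^2) \<longlongrightarrow> 0) at_top" by real_asymp
    then have "((\<lambda>R. norm ((p - c)^2 / of_real (R^2))) \<longlongrightarrow> 0) at_top"
      by (simp add: norm_divide norm_power)
    then show "((\<lambda>R. (p - c)^2 / of_real (R^2)) \<longlongrightarrow> 0) at_top"
      using tendsto_norm_zero_iff by blast
  qed
  have u: "((\<lambda>R. 2 / R) \<longlongrightarrow> (0::real)) at_top" by real_asymp
  have "\<forall>\<^sub>F R in at_top. norm (F p * (1 + (p - c)^2 / of_real (R^2))) \<le> 2 / R"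
    using eventually_gt_at_top[of "norm (p - c)"] by eventually_elim (rule key)
  then have "norm (F p * (1 + 0)) \<le> 0"
    using tendsto_le[OF trivial_limit_at_top_linorder u l] by blast
  then show ?thesis by simp
qed

section \<open>Oriented Laplace integrals and their limits\<close>

text \<open>Oriented like an integral from 0 to T: the limit at \<open>at_top\<close> is the
  right-hand transform, the limit at \<open>at_bot\<close> is minus the left-hand one. With this
  sign both satisfy the same algebraic relation, which is what allows them to be glued.\<close>

definition laplace_int :: "(real \<Rightarrow> complex) \<Rightarrow> complex \<Rightarrow> real \<Rightarrow> complex" where
  "laplace_int f s T =
     (if 0 \<le> T then integral {0..T} (\<lambda>t. f t * exp (- s * of_real t))
      else - integral {T..0} (\<lambda>t. f t * exp (- s * of_real t)))"

lemma laplace_int_0 [simp]: "laplace_int f s 0 = 0"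
  by (simp add: laplace_int_def)

lemma laplace_int_diff:
  assumes "continuous_on UNIV f" "a \<le> b"
  shows "laplace_int f s b - laplace_int f s a = integral {a..b} (\<lambda>t. f t * exp (- s * of_real t))"
proof -
  let ?g = "\<lambda>t. f t * exp (- s * of_real t)"
  have int: "?g integrable_on {c..d}" for c d
    by (intro integrable_continuous_interval continuous_intros continuous_on_subset[OF assms(1)]) auto
  consider "0 \<le> a" | "a < 0" "0 \<le> b" | "b < 0" by linarith
  then show ?thesis
  proof cases
    case 1
    then show ?thesis using assms(2) Henstock_Kurzweil_Integration.integral_combine[OF 1 assms(2) int]
      by (simp add: laplace_int_def algebra_simps)
  next
    case 2
    then show ?thesis using Henstock_Kurzweil_Integration.integral_combine[of a 0 b, OF _ _ int]
      by (simp add: laplace_int_def algebra_simps)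
  next
    case 3
    then show ?thesis using assms(2) Henstock_Kurzweil_Integration.integral_combine[of a b 0, OF _ _ int]
      by (auto simp add: laplace_int_def algebra_simps)
  qed
qed

lemma has_vector_derivative_laplace_int:
  assumes f: "continuous_on UNIV f"
  shows "(laplace_int f s has_vector_derivative f T * exp (- s * of_real T)) (at T)"
proof -
  let ?g = "\<lambda>t. f t * exp (- s * of_real t)"
  have "((\<lambda>u. integral {T - 1..u} ?g) has_vector_derivative ?g T) (at T within {T - 1..T + 1})"
    by (intro integral_has_vector_derivative continuous_intros continuous_on_subset[OF f]) auto
  then have "((\<lambda>u. integral {T - 1..u} ?g) has_vector_derivative ?g T) (at T)"
    by (subst (asm) at_within_Icc_at) auto
  then have "((\<lambda>u. laplace_int f s (T - 1) + integral {T - 1..u} ?g) has_vector_derivative ?g T) (at T)"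
    by (auto intro!: derivative_eq_intros)
  then show ?thesis
  proof (rule has_vector_derivative_transform_within_open[of _ _ _ "{T - 1<..}"])
    fix u assume "u \<in> {T - 1<..}"
    then show "laplace_int f s (T - 1) + integral {T - 1..u} ?g = laplace_int f s u"
      using laplace_int_diff[OF f, of "T - 1" u s] by (simp add: algebra_simps)
  qed auto
qed

lemma holomorphic_laplace_int:
  assumes f: "continuous_on UNIV f"
  shows "(\<lambda>s. laplace_int f s T) holomorphic_on A"
proof -
  have *: "(\<lambda>s. integral (cbox a b) (\<lambda>t. f t * exp (- s * of_real t))) holomorphic_on UNIV" for a b
  proof (rule leibniz_rule_holomorphic)
    fix s :: complex and t :: real
    show "((\<lambda>s. f t * exp (- s * of_real t)) has_field_derivative
            f t * (- of_real t * exp (- s * of_real t))) (at s within UNIV)"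
      by (auto intro!: derivative_eq_intros)
    show "(\<lambda>t. f t * exp (- s * of_real t)) integrable_on cbox a b"
      by (intro integrable_continuous continuous_intros continuous_on_subset[OF f]) auto
  next
    have "continuous_on (UNIV \<times> cbox a b) (\<lambda>p. f (snd p))"
      by (rule continuous_on_compose2[OF f]) (auto intro: continuous_intros)
    then show "continuous_on (UNIV \<times> cbox a b)
            (\<lambda>(s, t). f t * (- of_real t * exp (- s * of_real t)))"
      unfolding split_beta by (intro continuous_intros)
  qed auto
  have "(\<lambda>s. laplace_int f s T) holomorphic_on UNIV"
  proof (cases "0 \<le> T")
    case True
    then show ?thesis using *[of 0 T] by (simp add: laplace_int_def)
  next
    case False
    then show ?thesis using holomorphic_on_minus[OF *[of T 0]] by (simp add: laplace_int_def)
  qed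
  then show ?thesis using holomorphic_on_subset by blast
qed

text \<open>The bound does not depend on \<open>b\<close>. This one tail estimate yields the
  existence of the limit, the bound on the transform (\<open>a = 0\<close>), and the locally uniform
  convergence that makes the limit holomorphic.\<close>

lemma norm_laplace_int_diff_le:
  assumes f: "continuous_on UNIV f" and b: "\<And>t. a \<le> t \<Longrightarrow> norm (f t) \<le> exp (\<sigma> * t)"
    and s: "\<sigma> < Re s" and ab: "a \<le> b"
  shows "norm (laplace_int f s b - laplace_int f s a) \<le> exp (- (Re s - \<sigma>) * a) / (Re s - \<sigma>)"
proof -
  define d where "d = Re s - \<sigma>"
  have d: "d > 0" using s d_def by simp
  have hi: "((\<lambda>t. exp (- d * t)) has_integral (- exp (- d * b) / d - - exp (- d * a) / d)) {a..b}"
    using d ab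
    by (intro fundamental_theorem_of_calculus)
      (auto intro!: derivative_eq_intros simp flip: has_real_derivative_iff_has_vector_derivative)
  have "norm (integral {a..b} (\<lambda>t. f t * exp (- s * of_real t)))
      \<le> integral {a..b} (\<lambda>t. exp (- d * t))"
  proof (rule integral_norm_bound_integral)
    show "(\<lambda>t. f t * exp (- s * of_real t)) integrable_on {a..b}"
      by (intro integrable_continuous_interval continuous_intros continuous_on_subset[OF f]) auto
    show "(\<lambda>t. exp (- d * t)) integrable_on {a..b}" using hi by blast
    fix t assume t: "t \<in> {a..b}"
    then have "norm (f t * exp (- s * of_real t)) \<le> exp (\<sigma> * t) * exp (- Re s * t)"
      using b[of t] by (auto simp: norm_mult intro!: mult_mono)
    also have "\<dots> = exp (- d * t)" by (simp add: d_def algebra_simps flip: exp_add)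
    finally show "norm (f t * exp (- s * of_real t)) \<le> exp (- d * t)" .
  qed
  also have "\<dots> = - exp (- d * b) / d - - exp (- d * a) / d"
    using hi by (rule integral_unique)
  also have "\<dots> \<le> exp (- d * a) / d" using d by simp
  finally show ?thesis using laplace_int_diff[OF f ab] d_def by simp
qed

lemma laplace_transform_exists:
  assumes f: "continuous_on UNIV f" and b: "\<And>t. 0 \<le> t \<Longrightarrow> norm (f t) \<le> exp (\<sigma> * t)"
  obtains F where "F holomorphic_on {s. \<sigma> < Re s}"
    and "\<And>s. \<sigma> < Re s \<Longrightarrow> (laplace_int f s \<longlongrightarrow> F s) at_top"
    and "\<And>s. \<sigma> < Re s \<Longrightarrow> norm (F s) \<le> 1 / (Re s - \<sigma>)"
proof -
  define L where "L n s = laplace_int f s (real n)" for n s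
  have diff: "norm (laplace_int f s v - laplace_int f s u) \<le> exp (- (Re s - \<sigma>) * u) / (Re s - \<sigma>)"
    if "\<sigma> < Re s" "0 \<le> u" "u \<le> v" for s u v
    using that by (intro norm_laplace_int_diff_le f b) auto
  have "\<exists>l. (laplace_int f s \<longlongrightarrow> l) at_top" if s: "\<sigma> < Re s" for s
  proof -
    have "((\<lambda>u. exp (- (Re s - \<sigma>) * u) / (Re s - \<sigma>)) \<longlongrightarrow> 0) at_top"
      using s by real_asymp
    then have small: "\<forall>\<^sub>F u in at_top. exp (- (Re s - \<sigma>) * u) / (Re s - \<sigma>) < e" if "e > 0" for e
      using that by (rule order_tendstoD(2))
    have "cauchy_filter (filtermap (laplace_int f s) at_top)"
      unfolding cauchy_filter_metric_filtermap
    proof (intro allI impI)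
      fix e :: real assume e: "e > 0"
      obtain u where u: "u \<ge> 0" "exp (- (Re s - \<sigma>) * u) / (Re s - \<sigma>) < e / 2"
        using eventually_conj[OF small[of "e/2"] eventually_ge_at_top[of 0]] e
        by (auto simp: eventually_at_top_linorder)
      have near: "norm (laplace_int f s v - laplace_int f s u) < e / 2" if "v \<ge> u" for v
        using diff[OF s u(1) that] u(2) by linarith
      have "dist (laplace_int f s x) (laplace_int f s y) < e" if "x \<ge> u" "y \<ge> u" for x y
        using near[OF that(1)] near[OF that(2)] dist_triangle_half_l[of "laplace_int f s u"]
        by (metis dist_norm dist_commute dist_triangle_half_l)
      then show "\<exists>P. eventually P at_top \<and>
          (\<forall>x y. P x \<and> P y \<longrightarrow> dist (laplace_int f s x) (laplace_int f s y) < e)"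
        using eventually_ge_at_top by blast
    qed
    then show ?thesis
      using cauchy_filter_convergent[of "filtermap (laplace_int f s) at_top"]
      by (auto simp: convergent_filter_iff filterlim_def)
  qed
  then obtain F where F: "\<And>s. \<sigma> < Re s \<Longrightarrow> (laplace_int f s \<longlongrightarrow> F s) at_top"
    by metis
  have F_bd: "norm (F s - laplace_int f s u) \<le> exp (- (Re s - \<sigma>) * u) / (Re s - \<sigma>)"
    if "\<sigma> < Re s" "0 \<le> u" for s u
  proof (rule tendsto_upperbound)
    show "((\<lambda>v. norm (laplace_int f s v - laplace_int f s u)) \<longlongrightarrow> norm (F s - laplace_int f s u)) at_top"
      by (intro tendsto_intros F that)
    show "\<forall>\<^sub>F v in at_top. norm (laplace_int f s v - laplace_int f s u)
        \<le> exp (- (Re s - \<sigma>) * u) / (Re s - \<sigma>)"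
      using eventually_ge_at_top[of u] by eventually_elim (use diff that in auto)
  qed simp
  show ?thesis
  proof (rule that[OF _ F])
    show "norm (F s) \<le> 1 / (Re s - \<sigma>)" if "\<sigma> < Re s" for s
      using F_bd[OF that, of 0] by simp
    show "F holomorphic_on {s. \<sigma> < Re s}"
    proof (rule holomorphic_uniform_sequence[of _ L])
      show "open {s. \<sigma> < Re s}" by (rule open_halfspace_Re_gt)
      show "L n holomorphic_on {s. \<sigma> < Re s}" for n
        unfolding L_def using holomorphic_laplace_int[OF f] by blast
      fix s assume "s \<in> {s. \<sigma> < Re s}"
      \<comment> \<open>Half the distance to the line: on \<open>cball s d\<close> the distance
        stays at least \<open>d\<close>, so the tail bound becomes uniform.\<close>
      define d where "d = (Re s - \<sigma>) / 2"
      have d: "d > 0" using \<open>s \<in> _\<close> d_def by simp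
      have re: "Re x - \<sigma> \<ge> d" if "x \<in> cball s d" for x
      proof -
        have "\<bar>Re (s - x)\<bar> \<le> d"
          using that abs_Re_le_cmod[of "s - x"] by (simp add: dist_norm)
        then show ?thesis unfolding d_def minus_complex.sel by argo
      qed
      have "uniform_limit (cball s d) L F sequentially"
      proof (rule uniform_limitI)
        fix e :: real assume e: "e > 0"
        have "(\<lambda>n. exp (- d * real n) / d) \<longlonglongrightarrow> 0" using d by real_asymp
        then have "\<forall>\<^sub>F n in sequentially. exp (- d * real n) / d < e"
          using e by (rule order_tendstoD(2))
        then show "\<forall>\<^sub>F n in sequentially. \<forall>x\<in>cball s d. dist (L n x) (F x) < e"
        proof eventually_elim
          fix n assume n: "exp (- d * real n) / d < e"
          show "\<forall>x\<in>cball s d. dist (L n x) (F x) < e"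
          proof
            fix x assume x: "x \<in> cball s d"
            have "dist (L n x) (F x) \<le> exp (- (Re x - \<sigma>) * real n) / (Re x - \<sigma>)"
              using F_bd[of x "real n"] re[OF x] d by (simp add: dist_norm norm_minus_commute L_def)
            also have "\<dots> \<le> exp (- d * real n) / d"
            proof (rule frac_le)
              show "exp (- (Re x - \<sigma>) * real n) \<le> exp (- d * real n)"
                using mult_right_mono[OF re[OF x], of "real n"] by (simp add: left_diff_distrib)
            qed (use re[OF x] d in auto)
            finally show "dist (L n x) (F x) < e" using n by linarith
          qed
        qed
      qed
      moreover have "cball s d \<subseteq> {s. \<sigma> < Re s}"
      proof
        fix x assume "x \<in> cball s d"
        from re[OF this] d show "x \<in> {s. \<sigma> < Re s}" by simp
      qed
      ultimately show "\<exists>d>0. cball s d \<subseteq> {s. \<sigma> < Re s} \<and> uniform_limit (cball s d) L F sequentially"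
        using d by blast
    qed
  qed
qed

lemma laplace_int_reflect:
  "laplace_int (\<lambda>t. f (- t)) (- s) (- T) = - laplace_int f s T"
proof -
  have "integral {a..b} (\<lambda>t. f (- t) * exp (s * of_real t))
      = integral {- b..- a} (\<lambda>t. f t * exp (- s * of_real t))" for a b
    using Henstock_Kurzweil_Integration.integral_reflect_real[of "- a" "- b" "\<lambda>t. f t * exp (- s * of_real t)"] by simp
  from this[of 0 "- T"] this[of "- T" 0] show ?thesis by (simp add: laplace_int_def)
qed

lemma laplace_transform_exists_left:
  assumes f: "continuous_on UNIV f" and b: "\<And>t. t \<le> 0 \<Longrightarrow> norm (f t) \<le> exp (\<sigma> * t)"
  obtains F where "F holomorphic_on {s. Re s < \<sigma>}"
    and "\<And>s. Re s < \<sigma> \<Longrightarrow> (laplace_int f s \<longlongrightarrow> F s) at_bot"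
    and "\<And>s. Re s < \<sigma> \<Longrightarrow> norm (F s) \<le> 1 / (\<sigma> - Re s)"
proof -
  have f': "continuous_on UNIV (\<lambda>t. f (- t))"
    by (intro continuous_on_compose2[OF f] continuous_intros) auto
  have b': "norm (f (- t)) \<le> exp (- \<sigma> * t)" if "0 \<le> t" for t
    using b[of "- t"] that by simp
  obtain H where hol: "H holomorphic_on {s. - \<sigma> < Re s}"
    and lim: "\<And>s. - \<sigma> < Re s \<Longrightarrow> (laplace_int (\<lambda>t. f (- t)) s \<longlongrightarrow> H s) at_top"
    and bd: "\<And>s. - \<sigma> < Re s \<Longrightarrow> norm (H s) \<le> 1 / (Re s - - \<sigma>)"
    using laplace_transform_exists[OF f', of "- \<sigma>"] b' by blast
  \<comment> \<open>Time reversal exchanges \<open>s\<close> with \<open>- s\<close> and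
    \<open>\<sigma>\<close> with \<open>- \<sigma>\<close>; the outer sign comes from the
    orientation of \<open>laplace_int\<close>.\<close>
  show ?thesis
  proof (rule that[of "\<lambda>s. - H (- s)"])
    have "(H \<circ> uminus) holomorphic_on {s. Re s < \<sigma>}"
      by (rule holomorphic_on_compose_gen[OF _ hol]) (auto intro: holomorphic_intros)
    then show "(\<lambda>s. - H (- s)) holomorphic_on {s. Re s < \<sigma>}"
      by (auto simp: o_def intro: holomorphic_intros)
    show "(laplace_int f s \<longlongrightarrow> - H (- s)) at_bot" if "Re s < \<sigma>" for s
    proof -
      have "((\<lambda>T. - laplace_int (\<lambda>t. f (- t)) (- s) (- T)) \<longlongrightarrow> - H (- s)) at_bot"
        by (intro tendsto_minus filterlim_compose[OF lim filterlim_uminus_at_top_at_bot]) (use that in auto)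
      then show ?thesis by (simp add: laplace_int_reflect)
    qed
    show "norm (- H (- s)) \<le> 1 / (\<sigma> - Re s)" if "Re s < \<sigma>" for s
      using bd[of "- s"] that by (simp add: algebra_simps)
  qed
qed

section \<open>The characteristic function and complete solutions of the scalar equation\<close>

definition char_fun :: "complex \<Rightarrow> complex \<Rightarrow> complex \<Rightarrow> real \<Rightarrow> complex \<Rightarrow> complex" where
  "char_fun k1 k2 c \<tau> s = s\<^sup>2 + (k2 * s + k1) * (1 - c * exp (- (of_real \<tau> * s)))"

lemma holomorphic_char_fun [holomorphic_intros]: "char_fun k1 k2 c \<tau> holomorphic_on A"
  unfolding char_fun_def by (intro holomorphic_intros)

lemma laplace_int_derivative:
  assumes z': "\<And>t. (z has_vector_derivative v t) (at t)" and "continuous_on UNIV v"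
  shows "laplace_int v s T = z T * exp (- s * of_real T) - z 0 + s * laplace_int z s T"
proof -
  have z: "continuous_on UNIV z"
    using z' by (intro continuous_at_imp_continuous_on) (auto intro: has_vector_derivative_continuous)
  \<comment> \<open>The two sides have the same derivative in T and agree at 0. Unlike integration
    by parts, this treats positive and negative T alike; the shift rule below is obtained in the
    same way.\<close>
  define D where "D t = laplace_int v s t - z t * exp (- s * of_real t) - s * laplace_int z s t" for t
  have e': "((\<lambda>t. exp (- s * of_real t)) has_vector_derivative - s * exp (- s * of_real t)) (at t)" for t
    by (rule has_vector_derivative_eq_rhs[OF has_vector_derivative_real_field])
      (auto intro!: derivative_eq_intros)
  have "(D has_vector_derivative 0) (at t)" for t
    unfolding D_def
    by (rule derivative_eq_intros e' z' has_vector_derivative_laplace_int z assms refl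
      has_vector_derivative_mult | simp add: algebra_simps)+
  then have "D T = D 0"
    using has_vector_derivative_zero_constant[of UNIV D]
    by (metis UNIV_I convex_UNIV)
  then show ?thesis by (simp add: D_def algebra_simps)
qed

lemma laplace_int_shift:
  assumes f: "continuous_on UNIV f"
  shows "laplace_int (\<lambda>t. f (t - \<tau>)) s T
    = exp (- (of_real \<tau> * s)) * (laplace_int f s (T - \<tau>) - laplace_int f s (- \<tau>))"
proof -
  have f\<tau>: "continuous_on UNIV (\<lambda>t. f (t - \<tau>))"
    by (intro continuous_on_compose2[OF f] continuous_intros) auto
  have sh: "((\<lambda>t. laplace_int f s (t - \<tau>)) has_vector_derivative
      f (t - \<tau>) * exp (- s * of_real (t - \<tau>))) (at t)" for t
  proof -
    have "((\<lambda>t. t - \<tau>) has_vector_derivative 1) (at t)"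
      by (auto intro!: derivative_eq_intros)
    from vector_diff_chain_at[OF this has_vector_derivative_laplace_int[OF f]]
    show ?thesis by (simp add: o_def)
  qed
  define D where "D t = laplace_int (\<lambda>t. f (t - \<tau>)) s t
    - exp (- (of_real \<tau> * s)) * laplace_int f s (t - \<tau>)" for t
  have "(D has_vector_derivative 0) (at t)" for t
    unfolding D_def
    by (rule has_vector_derivative_eq_rhs[OF has_vector_derivative_diff[OF
          has_vector_derivative_laplace_int[OF f\<tau>] has_vector_derivative_mult_right[OF sh]]])
      (simp add: algebra_simps flip: exp_add)
  then have "D T = D 0"
    using has_vector_derivative_zero_constant[of UNIV D]
    by (metis UNIV_I convex_UNIV)
  then show ?thesis by (simp add: D_def algebra_simps)
qed

lemma laplace_int_linear:
  assumes "continuous_on UNIV f" "continuous_on UNIV g"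
  shows "laplace_int (\<lambda>t. c * f t + d * g t) s T = c * laplace_int f s T + d * laplace_int g s T"
proof -
  have "integral {a..b} (\<lambda>t. (c * f t + d * g t) * exp (- s * of_real t))
     = c * integral {a..b} (\<lambda>t. f t * exp (- s * of_real t))
     + d * integral {a..b} (\<lambda>t. g t * exp (- s * of_real t))" for a b
  proof -
    have "(\<lambda>t. f t * exp (- s * of_real t)) integrable_on {a..b}"
      "(\<lambda>t. g t * exp (- s * of_real t)) integrable_on {a..b}"
      by (intro integrable_continuous_interval continuous_intros continuous_on_subset[OF assms(1)]
        continuous_on_subset[OF assms(2)]; simp)+
    then have "((\<lambda>t. c * (f t * exp (- s * of_real t)) + d * (g t * exp (- s * of_real t))) has_integral
      c * integral {a..b} (\<lambda>t. f t * exp (- s * of_real t))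
      + d * integral {a..b} (\<lambda>t. g t * exp (- s * of_real t))) {a..b}"
      by (intro has_integral_add has_integral_mult_right integrable_integral)
    then show ?thesis by (simp add: integral_unique algebra_simps)
  qed
  then show ?thesis by (simp add: laplace_int_def)
qed

text \<open>Roots off the line Re s = \<sigma> do no harm: on either side one of the transforms is
  holomorphic by itself, and the quotient by \<open>char_fun\<close> only joins them across the
  line. Vanishing at time 0 is enough, since the hypotheses survive a shift of time after
  rescaling.\<close>

lemma delay_liouville:
  fixes z v :: "real \<Rightarrow> complex"
  assumes z': "\<And>t. (z has_vector_derivative v t) (at t)"
    and v': "\<And>t. (v has_vector_derivative
          c * (k1 * z (t - \<tau>) + k2 * v (t - \<tau>)) - k1 * z t - k2 * v t) (at t)"
    and bz: "\<And>t. norm (z t) \<le> exp (\<sigma> * t)" and bv: "\<And>t. norm (v t) \<le> exp (\<sigma> * t)"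
    and nz: "\<And>s. Re s = \<sigma> \<Longrightarrow> char_fun k1 k2 c \<tau> s \<noteq> 0"
  shows "z 0 = 0"
proof -
  have cz: "continuous_on UNIV z" and cv: "continuous_on UNIV v"
    using z' v' by (auto intro!: continuous_at_imp_continuous_on intro: has_vector_derivative_continuous)
  have cz\<tau>: "continuous_on UNIV (\<lambda>t. z (t - \<tau>))" and cv\<tau>: "continuous_on UNIV (\<lambda>t. v (t - \<tau>))"
    by (intro continuous_on_compose2[OF cz] continuous_on_compose2[OF cv] continuous_intros; simp)+
  let ?E = "\<lambda>s. exp (- (of_real \<tau> * s))"
  let ?Z = "laplace_int z" and ?V = "laplace_int v"
  have V: "?V s T = z T * exp (- s * of_real T) - z 0 + s * ?Z s T" for s T
    by (rule laplace_int_derivative[OF z' cv])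
  have A: "v T * exp (- s * of_real T) - v 0 + s * ?V s T =
      c * (?E s * (k1 * (?Z s (T - \<tau>) - ?Z s (- \<tau>)) + k2 * (?V s (T - \<tau>) - ?V s (- \<tau>))))
      - k1 * ?Z s T - k2 * ?V s T" for s T
  proof -
    let ?a = "\<lambda>t. 1 * (c * (k1 * z (t - \<tau>) + k2 * v (t - \<tau>))) + (-1) * (k1 * z t + k2 * v t)"
    have ca: "continuous_on UNIV ?a" by (intro continuous_intros cz cv cz\<tau> cv\<tau>)
    have va: "(v has_vector_derivative ?a t) (at t)" for t using v'[of t] by (simp add: algebra_simps)
    have i1: "laplace_int (\<lambda>t. k1 * z t + k2 * v t) s T = k1 * ?Z s T + k2 * ?V s T"
      by (rule laplace_int_linear[OF cz cv])
    have i2: "laplace_int (\<lambda>t. k1 * z (t - \<tau>) + k2 * v (t - \<tau>)) s T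
      = k1 * laplace_int (\<lambda>t. z (t - \<tau>)) s T + k2 * laplace_int (\<lambda>t. v (t - \<tau>)) s T"
      by (rule laplace_int_linear[OF cz\<tau> cv\<tau>])
    have i3: "laplace_int (\<lambda>t. c * (k1 * z (t - \<tau>) + k2 * v (t - \<tau>)) + 0 * z t) s T
      = c * laplace_int (\<lambda>t. k1 * z (t - \<tau>) + k2 * v (t - \<tau>)) s T + 0 * ?Z s T"
      by (rule laplace_int_linear) (intro continuous_intros cz cv cz\<tau> cv\<tau>)+
    then have i3': "laplace_int (\<lambda>t. c * (k1 * z (t - \<tau>) + k2 * v (t - \<tau>))) s T
      = c * laplace_int (\<lambda>t. k1 * z (t - \<tau>) + k2 * v (t - \<tau>)) s T"
      by simp
    have i4: "laplace_int ?a s T = 1 * laplace_int (\<lambda>t. c * (k1 * z (t - \<tau>) + k2 * v (t - \<tau>))) s T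
      + (-1) * laplace_int (\<lambda>t. k1 * z t + k2 * v t) s T"
      by (rule laplace_int_linear) (intro continuous_intros cz cv cz\<tau> cv\<tau>)+
    have "laplace_int ?a s T = v T * exp (- s * of_real T) - v 0 + s * ?V s T"
      by (rule laplace_int_derivative[OF va ca])
    then show ?thesis
      unfolding i4 i3' i2 i1 laplace_int_shift[OF cz] laplace_int_shift[OF cv]
      by (simp add: algebra_simps)
  qed
  \<comment> \<open>The contribution of the values at time 0 and of the integrals between -\<tau>
    and 0. It is entire in \<open>s\<close> and the same for both time directions, so off the roots
    both transforms are the quotient of \<open>N s\<close> by the characteristic function.\<close>
  define N where "N s = (s + k2 - c * ?E s * k2) * z 0 + v 0
      - c * ?E s * (k1 * ?Z s (- \<tau>) + k2 * ?V s (- \<tau>))" for s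
  \<comment> \<open>An arbitrary filter is allowed so that one computation serves both ends of the
    time axis.\<close>
  have limit: "char_fun k1 k2 c \<tau> s * Zs = N s \<and> Vs = s * Zs - z 0"
    if lim: "(?Z s \<longlongrightarrow> Zs) F" "(?V s \<longlongrightarrow> Vs) F"
      "((\<lambda>T. ?Z s (T - \<tau>)) \<longlongrightarrow> Zs) F" "((\<lambda>T. ?V s (T - \<tau>)) \<longlongrightarrow> Vs) F"
      and e: "((\<lambda>T. z T * exp (- s * of_real T)) \<longlongrightarrow> 0) F" "((\<lambda>T. v T * exp (- s * of_real T)) \<longlongrightarrow> 0) F"
      and F: "F \<noteq> bot" for s Zs Vs F
  proof -
    have "((\<lambda>T. z T * exp (- s * of_real T) - z 0 + s * ?Z s T) \<longlongrightarrow> 0 - z 0 + s * Zs) F"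
      by (intro tendsto_intros lim e)
    then have Vs: "Vs = s * Zs - z 0"
      using tendsto_unique[OF F lim(2)] ext[of "?V s", OF V] by simp
    have "((\<lambda>T. v T * exp (- s * of_real T) - v 0 + s * ?V s T) \<longlongrightarrow> 0 - v 0 + s * Vs) F"
      by (intro tendsto_intros lim e)
    moreover have "((\<lambda>T. v T * exp (- s * of_real T) - v 0 + s * ?V s T) \<longlongrightarrow>
        c * (?E s * (k1 * (Zs - ?Z s (- \<tau>)) + k2 * (Vs - ?V s (- \<tau>)))) - k1 * Zs - k2 * Vs) F"
      unfolding A by (intro tendsto_intros lim)
    ultimately have "0 - v 0 + s * Vs
        = c * (?E s * (k1 * (Zs - ?Z s (- \<tau>)) + k2 * (Vs - ?V s (- \<tau>)))) - k1 * Zs - k2 * Vs"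
      using tendsto_unique[OF F] by blast
    then show ?thesis using Vs
      unfolding char_fun_def N_def by (auto simp: algebra_simps power2_eq_square)
  qed
  have decay: "((\<lambda>T. f T * exp (- s * of_real T)) \<longlongrightarrow> 0) F"
    if "\<And>t. norm (f t) \<le> exp (\<sigma> * t)" and "((\<lambda>T. exp ((\<sigma> - Re s) * T)) \<longlongrightarrow> 0) F"
    for f :: "real \<Rightarrow> complex" and s F
  proof (rule Lim_null_comparison[OF _ that(2)], rule always_eventually, rule allI)
    fix T
    have "norm (f T * exp (- s * of_real T)) \<le> exp (\<sigma> * T) * exp (- Re s * T)"
      using that(1)[of T] by (simp add: norm_mult)
    also have "\<dots> = exp ((\<sigma> - Re s) * T)" by (simp add: algebra_simps flip: exp_add)
    finally show "norm (f T * exp (- s * of_real T)) \<le> exp ((\<sigma> - Re s) * T)" .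
  qed
  obtain Zp where Zp: "Zp holomorphic_on {s. \<sigma> < Re s}"
      "\<And>s. \<sigma> < Re s \<Longrightarrow> (?Z s \<longlongrightarrow> Zp s) at_top"
      "\<And>s. \<sigma> < Re s \<Longrightarrow> norm (Zp s) \<le> 1 / (Re s - \<sigma>)"
    using laplace_transform_exists[OF cz bz] by blast
  obtain Vp where "Vp holomorphic_on {s. \<sigma> < Re s}" and Vp: "\<And>s. \<sigma> < Re s \<Longrightarrow> (?V s \<longlongrightarrow> Vp s) at_top"
      "\<And>s. \<sigma> < Re s \<Longrightarrow> norm (Vp s) \<le> 1 / (Re s - \<sigma>)"
    using laplace_transform_exists[OF cv bv] by blast
  obtain Zm where Zm: "Zm holomorphic_on {s. Re s < \<sigma>}"
      "\<And>s. Re s < \<sigma> \<Longrightarrow> (?Z s \<longlongrightarrow> Zm s) at_bot"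
      "\<And>s. Re s < \<sigma> \<Longrightarrow> norm (Zm s) \<le> 1 / (\<sigma> - Re s)"
    using laplace_transform_exists_left[OF cz bz] by blast
  obtain Vm where "Vm holomorphic_on {s. Re s < \<sigma>}"
      and Vm: "\<And>s. Re s < \<sigma> \<Longrightarrow> (?V s \<longlongrightarrow> Vm s) at_bot"
      "\<And>s. Re s < \<sigma> \<Longrightarrow> norm (Vm s) \<le> 1 / (\<sigma> - Re s)"
    using laplace_transform_exists_left[OF cv bv] by blast
  have p: "char_fun k1 k2 c \<tau> s * Zp s = N s \<and> Vp s = s * Zp s - z 0" if s: "\<sigma> < Re s" for s
  proof (rule limit)
    have sh: "LIM T at_top. T - \<tau> :> at_top" for \<tau> :: real by real_asymp
    have e: "((\<lambda>T. exp ((\<sigma> - Re s) * T)) \<longlongrightarrow> 0) at_top" using s by real_asymp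
    show "((\<lambda>T. ?Z s (T - \<tau>)) \<longlongrightarrow> Zp s) at_top" "((\<lambda>T. ?V s (T - \<tau>)) \<longlongrightarrow> Vp s) at_top"
      by (rule filterlim_compose[OF Zp(2)[OF s] sh] filterlim_compose[OF Vp(1)[OF s] sh])+
    show "((\<lambda>T. z T * exp (- s * of_real T)) \<longlongrightarrow> 0) at_top" "((\<lambda>T. v T * exp (- s * of_real T)) \<longlongrightarrow> 0) at_top"
      by (rule decay[OF bz e] decay[OF bv e])+
  qed (use Zp(2)[OF s] Vp(1)[OF s] in auto)
  have m: "char_fun k1 k2 c \<tau> s * Zm s = N s \<and> Vm s = s * Zm s - z 0" if s: "Re s < \<sigma>" for s
  proof (rule limit)
    have sh: "LIM T at_bot. T - \<tau> :> at_bot" for \<tau> :: real by real_asymp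
    have e: "((\<lambda>T. exp ((\<sigma> - Re s) * T)) \<longlongrightarrow> 0) at_bot" using s by real_asymp
    show "((\<lambda>T. ?Z s (T - \<tau>)) \<longlongrightarrow> Zm s) at_bot" "((\<lambda>T. ?V s (T - \<tau>)) \<longlongrightarrow> Vm s) at_bot"
      by (rule filterlim_compose[OF Zm(2)[OF s] sh] filterlim_compose[OF Vm(1)[OF s] sh])+
    show "((\<lambda>T. z T * exp (- s * of_real T)) \<longlongrightarrow> 0) at_bot" "((\<lambda>T. v T * exp (- s * of_real T)) \<longlongrightarrow> 0) at_bot"
      by (rule decay[OF bz e] decay[OF bv e])+
  qed (use Zm(2)[OF s] Vm(1)[OF s] in auto)
  define F where "F s = (if \<sigma> < Re s then Zp s else if Re s < \<sigma> then Zm s else N s / char_fun k1 k2 c \<tau> s)" for s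
  have F_eq: "F s = N s / char_fun k1 k2 c \<tau> s" if "char_fun k1 k2 c \<tau> s \<noteq> 0" for s
    using p[of s] m[of s] that by (auto simp: F_def field_simps)
  have holN: "N holomorphic_on A" for A
    unfolding N_def by (intro holomorphic_intros holomorphic_laplace_int cz cv)
  have "F field_differentiable at s" for s
  proof -
    consider "\<sigma> < Re s" | "Re s < \<sigma>" | "Re s = \<sigma>" by linarith
    then show ?thesis
    proof cases
      case 1
      have "F holomorphic_on {s. \<sigma> < Re s}"
        by (rule holomorphic_transform[OF Zp(1)]) (simp add: F_def)
      then show ?thesis
        using holomorphic_on_imp_differentiable_at[OF _ open_halfspace_Re_gt[of \<sigma>]] 1 by simp
    next
      case 2
      have "F holomorphic_on {s. Re s < \<sigma>}"
        by (rule holomorphic_transform[OF Zm(1)]) (simp add: F_def)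
      then show ?thesis
        using holomorphic_on_imp_differentiable_at[OF _ open_halfspace_Re_lt[of \<sigma>]] 2 by simp
    next
      case 3
      \<comment> \<open>Differentiability is local: near a point of the line there are no roots, and
        there \<open>F\<close> equals the quotient on both sides and on the line itself.\<close>
      let ?U = "{s. char_fun k1 k2 c \<tau> s \<noteq> 0}"
      have "continuous_on UNIV (char_fun k1 k2 c \<tau>)"
        by (intro holomorphic_on_imp_continuous_on holomorphic_intros)
      then have "open ?U" using open_Collect_neq continuous_on_const by blast
      moreover have "F holomorphic_on ?U"
      proof (rule holomorphic_transform)
        show "(\<lambda>s. N s / char_fun k1 k2 c \<tau> s) holomorphic_on ?U"
          by (intro holomorphic_intros holN) auto
      qed (simp add: F_eq)
      ultimately show ?thesis
        using holomorphic_on_imp_differentiable_at nz[OF 3] by blast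
    qed
  qed
  then have "F holomorphic_on UNIV"
    using field_differentiable_at_within by (auto simp: holomorphic_on_def)
  then have F0: "F s = 0" for s
  proof (rule entire_bounded_off_line_eq_0)
    show "norm (F s) \<le> 1 / \<bar>Re s - \<sigma>\<bar>" if "Re s \<noteq> \<sigma>" for s
      using Zp(3)[of s] Zm(3)[of s] that by (auto simp: F_def abs_if)
  qed
  \<comment> \<open>Once \<open>Zp\<close> vanishes, the transform of \<open>v\<close> is the
    constant \<open>- z 0\<close>. It also has to decay along the positive real axis, so no
    uniqueness theorem for the transform is needed.\<close>
  have "norm (z 0) \<le> 1 / (x - \<sigma>)" if "x > \<sigma>" for x :: real
  proof -
    have "Zp (of_real x) = 0" using F0[of "of_real x"] that by (simp add: F_def)
    then have "Vp (of_real x) = - z 0" using p[of "of_real x"] that by simp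
    then show ?thesis using Vp(2)[of "of_real x"] that by simp
  qed
  then have "\<forall>\<^sub>F x in at_top. norm (z 0) \<le> 1 / (x - \<sigma>)"
    using eventually_gt_at_top by (rule eventually_mono[rotated])
  moreover have "((\<lambda>x. 1 / (x - \<sigma>)) \<longlongrightarrow> 0) at_top" by real_asymp
  ultimately have "norm (z 0) \<le> 0"
    using tendsto_lowerbound trivial_limit_at_top_linorder by blast
  then show ?thesis by simp
qed

section \<open>Exponential decay from absence of complete solutions\<close>

text \<open>Position and velocity will form one point of the space, which gives a first order system
  with one delay. Linearity and autonomy permit rescaling and shifting; finite dimension provides
  compactness.\<close>

locale linear_delay =
  fixes A B :: "'a::euclidean_space \<Rightarrow> 'a" and \<tau> :: real
  assumes A: "bounded_linear A" and B: "bounded_linear B" and \<tau>: "0 \<le> \<tau>"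
begin

text \<open>Derivatives are taken within \<open>S\<close>, hence one-sided at its ends, and
  \<open>w (t - \<tau>)\<close> may be read outside \<open>S\<close>. This is how a free history
  enters a solution on \<open>{0..}\<close>, and why bounds on a window reach \<tau> further to the
  left.\<close>

definition solves_on :: "(real \<Rightarrow> 'a) \<Rightarrow> real set \<Rightarrow> bool" where
  "solves_on w S \<longleftrightarrow> (\<forall>t\<in>S. (w has_vector_derivative A (w t) + B (w (t - \<tau>))) (at t within S))"

definition K :: real where "K = onorm A + onorm B"

lemma K_nonneg: "0 \<le> K"
  unfolding K_def by (intro add_nonneg_nonneg onorm_pos_le A B)

lemma norm_field_le:
  assumes "norm x \<le> M" "norm y \<le> M"
  shows "norm (A x + B y) \<le> K * M"
proof -
  have "norm (A x + B y) \<le> onorm A * norm x + onorm B * norm y"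
    by (intro norm_triangle_le add_mono onorm A B)
  also have "\<dots> \<le> onorm A * M + onorm B * M"
    by (intro add_mono mult_left_mono assms onorm_pos_le A B)
  finally show ?thesis by (simp add: K_def algebra_simps)
qed

lemma solves_on_subset: "solves_on w S \<Longrightarrow> S' \<subseteq> S \<Longrightarrow> solves_on w S'"
  unfolding solves_on_def using has_vector_derivative_within_subset by blast

lemma solves_on_continuous: "solves_on w S \<Longrightarrow> continuous_on S w"
  unfolding solves_on_def continuous_on_eq_continuous_within
  using has_vector_derivative_continuous by blast

lemma solves_on_interior:
  assumes "solves_on w S" "t \<in> interior S"
  shows "(w has_vector_derivative A (w t) + B (w (t - \<tau>))) (at t)"
  using assms interior_subset at_within_interior unfolding solves_on_def by (metis subsetD)

lemma solves_on_shift_scale: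
  assumes "solves_on w S" and "\<And>t. t \<in> S' \<Longrightarrow> t0 + t \<in> S"
  shows "solves_on (\<lambda>t. c *\<^sub>R w (t0 + t)) S'"
  unfolding solves_on_def
proof
  fix t assume t: "t \<in> S'"
  have "((\<lambda>t. t0 + t) has_vector_derivative 1) (at t within S')"
    by (auto intro!: derivative_eq_intros)
  moreover have "(w has_vector_derivative A (w (t0 + t)) + B (w (t0 + t - \<tau>)))
      (at (t0 + t) within (\<lambda>t. t0 + t) ` S')"
    using assms t unfolding solves_on_def
    by (meson has_vector_derivative_within_subset image_subsetI)
  ultimately have "(w \<circ> (\<lambda>t. t0 + t) has_vector_derivative
      1 *\<^sub>R (A (w (t0 + t)) + B (w (t0 + t - \<tau>)))) (at t within S')"
    by (rule vector_diff_chain_within)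
  from has_vector_derivative_scaleR[OF DERIV_const[of c] this]
  show "((\<lambda>t. c *\<^sub>R w (t0 + t)) has_vector_derivative
      A (c *\<^sub>R w (t0 + t)) + B (c *\<^sub>R w (t0 + (t - \<tau>)))) (at t within S')"
    by (simp add: o_def linear_simps[OF A] linear_simps[OF B] scaleR_add_right algebra_simps)
qed

text \<open>A maximum argument in place of Gronwall's inequality. If the weighted norm
  \<open>u\<close> is largest at m > 0, the speed up to m is at most K u(m) exp(a t), and its
  integral is at most K / a < 1/2 of norm (w m). That half is absorbed, so u(m) is at most twice the
  maximum of \<open>u\<close> over the history.\<close>

lemma exponential_growth:
  assumes w: "solves_on w {0..}" and cont: "continuous_on {- \<tau>..} w"
  obtains M \<sigma> where "\<And>t. - \<tau> \<le> t \<Longrightarrow> norm (w t) \<le> M * exp (\<sigma> * t)"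
proof -
  define a where "a = 2 * K + 1"
  have a: "a > 0" using K_nonneg by (simp add: a_def)
  define u where "u t = norm (w t) * exp (- a * t)" for t
  have cu: "continuous_on {- \<tau>..T} u" for T
    unfolding u_def by (intro continuous_intros continuous_on_subset[OF cont]) auto
  obtain t1 where t1: "t1 \<in> {- \<tau>..0}" "\<And>t. t \<in> {- \<tau>..0} \<Longrightarrow> u t \<le> u t1"
    using continuous_attains_sup[OF _ _ cu[of 0]] \<tau> by auto
  have w_u: "norm (w t) = u t * exp (a * t)" for t
    by (simp add: u_def mult.assoc flip: exp_add)
  have "u T \<le> 2 * u t1" if T: "- \<tau> \<le> T" for T
  proof -
    obtain m where m: "m \<in> {- \<tau>..T}" "\<And>t. t \<in> {- \<tau>..T} \<Longrightarrow> u t \<le> u m"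
      using continuous_attains_sup[OF _ _ cu[of T]] T by auto
    have um: "u m \<ge> 0" by (simp add: u_def)
    have "u m \<le> 2 * u t1"
    proof (cases "m \<le> 0")
      case True
      have "u t1 \<ge> 0" by (simp add: u_def)
      then show ?thesis using t1(2)[of m] m(1) True by simp
    next
      case False
      have bd: "norm (w s) \<le> u m * exp (a * t)" if "- \<tau> \<le> s" "s \<le> t" "t \<le> m" for s t
        unfolding w_u using that m(1) a um by (intro mult_mono m(2)) auto
      have "norm (w m - w 0) \<le> K * u m * exp (a * m) / a - K * u m * exp (a * 0) / a"
      proof (rule differentiable_bound_general)
        show "continuous_on {0..m} w" using solves_on_continuous[OF w] continuous_on_subset by fastforce
        show "(w has_vector_derivative A (w t) + B (w (t - \<tau>))) (at t)" if "0 < t" for t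
          by (rule solves_on_interior[OF w]) (use that in auto)
        show "((\<lambda>t. K * u m * exp (a * t) / a) has_vector_derivative K * (u m * exp (a * t))) (at t)" for t
          using a unfolding has_real_derivative_iff_has_vector_derivative[symmetric]
          by (auto intro!: derivative_eq_intros)
        show "norm (A (w t) + B (w (t - \<tau>))) \<le> K * (u m * exp (a * t))" if "0 < t" "t < m" for t
          using that \<tau> by (intro norm_field_le bd) auto
      qed (use False a in \<open>auto intro!: continuous_intros\<close>)
      also have "\<dots> \<le> K / a * (u m * exp (a * m))" using divide_nonneg_pos[OF mult_nonneg_nonneg[OF K_nonneg um] a] by simp
      also have "\<dots> \<le> 1 / 2 * (u m * exp (a * m))"
        using um a K_nonneg by (intro mult_right_mono) (auto simp: a_def field_simps)
      finally have "norm (w m) \<le> norm (w 0) + u m * exp (a * m) / 2"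
        using norm_triangle_ineq2[of "w m" "w 0"] by simp
      then have "u m * exp (a * m) \<le> 2 * norm (w 0)" by (simp add: w_u[of m])
      also have "\<dots> = 2 * u 0" by (simp add: u_def)
      also have "\<dots> \<le> 2 * u t1" using t1(2)[of 0] \<tau> by simp
      finally have le: "u m * exp (a * m) \<le> 2 * u t1" .
      have "u m * 1 \<le> u m * exp (a * m)" using um a False by (intro mult_left_mono) auto
      then show ?thesis using le by simp
    qed
    then show ?thesis using m(2)[of T] T by simp
  qed
  then have "norm (w t) \<le> 2 * u t1 * exp (a * t)" if "- \<tau> \<le> t" for t
    unfolding w_u using that by (intro mult_right_mono) auto
  then show thesis by (rule that)
qed

section \<open>Compactness of solutions on growing windows\<close>

text \<open>The Arzela-Ascoli argument by hand: a diagonal subsequence converges at the rationals, a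
  Lipschitz bound uniform on bounded intervals extends this to all times, and the equation survives
  in integrated form.\<close>

lemma solves_on_UNIV_limit:
  fixes w :: "nat \<Rightarrow> real \<Rightarrow> 'a"
  assumes w: "\<And>n. solves_on (w n) {- real n..real n}"
    and bd: "\<And>n t. - real n - \<tau> \<le> t \<Longrightarrow> t \<le> real n \<Longrightarrow> norm (w n t) \<le> exp (\<sigma> * t)"
  obtains k g where "strict_mono (k :: nat \<Rightarrow> nat)" "solves_on g UNIV"
    and "\<And>t. (\<lambda>n. w (k n) t) \<longlonglongrightarrow> g t"
proof -
  \<comment> \<open>Weight and truncation make the whole family bounded by 1, as the diagonal
    selection demands. At a fixed time the truncation is eventually inactive.\<close>
  define f where "f n x = (if \<bar>x\<bar> \<le> real n then exp (- \<sigma> * x) *\<^sub>R w n x else 0)" for n x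
  have fb: "norm (f n x) \<le> 1" for n x
  proof -
    have "exp (- \<sigma> * x) * norm (w n x) \<le> exp (- \<sigma> * x) * exp (\<sigma> * x)" if "\<bar>x\<bar> \<le> real n"
      using that \<tau> by (intro mult_left_mono bd) auto
    then show ?thesis by (simp add: f_def flip: exp_add)
  qed
  obtain k where k: "strict_mono (k :: nat \<Rightarrow> nat)"
      and fk: "\<And>x. x \<in> \<rat> \<Longrightarrow> \<exists>l. (\<lambda>n. f (k n) x) \<longlonglongrightarrow> l"
    by (rule function_convergent_subsequence[of \<rat> f 1, OF countable_rat fb]) (rule that)
  have kn: "n \<le> k n" for n using k by (rule seq_suble)
  define L where "L m = K * exp (\<bar>\<sigma>\<bar> * (real m + \<tau>))" for m
  have L0: "L m \<ge> 0" for m unfolding L_def using K_nonneg by simp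
  have field_bd: "norm (A (w n t) + B (w n (t - \<tau>))) \<le> L m" if "m \<le> n" "\<bar>t\<bar> \<le> real m" for n m t
    unfolding L_def
  proof (rule norm_field_le)
    have *: "norm (w n s) \<le> exp (\<bar>\<sigma>\<bar> * (real m + \<tau>))" if "- real n - \<tau> \<le> s" "s \<le> real n"
      "\<bar>s\<bar> \<le> real m + \<tau>" for s
    proof -
      have "\<sigma> * s \<le> \<bar>\<sigma>\<bar> * \<bar>s\<bar>" by (metis abs_ge_self abs_mult)
      also have "\<dots> \<le> \<bar>\<sigma>\<bar> * (real m + \<tau>)" using that by (intro mult_left_mono) auto
      finally show ?thesis using bd[OF that(1,2)] by (meson exp_le_cancel_iff order_trans)
    qed
    show "norm (w n t) \<le> exp (\<bar>\<sigma>\<bar> * (real m + \<tau>))"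
      "norm (w n (t - \<tau>)) \<le> exp (\<bar>\<sigma>\<bar> * (real m + \<tau>))"
      using that \<tau> by (intro *; simp add: abs_le_iff)+
  qed
  have lip: "norm (w n y - w n x) \<le> L m * (y - x)"
    if "m \<le> n" "- real m \<le> x" "x \<le> y" "y \<le> real m" for n m x y
  proof (cases "x = y")
    case False
    have "norm (w n y - w n x) \<le> L m * y - L m * x"
    proof (rule differentiable_bound_general)
      show "continuous_on {x..y} (w n)"
        using that by (intro continuous_on_subset[OF solves_on_continuous[OF w]]) auto
      show "(w n has_vector_derivative A (w n t) + B (w n (t - \<tau>))) (at t)" if "x < t" "t < y" for t
        using that \<open>m \<le> n\<close> \<open>- real m \<le> x\<close> \<open>y \<le> real m\<close> by (intro solves_on_interior[OF w]) simp
      show "((\<lambda>t. L m * t) has_vector_derivative L m) (at t)" for t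
        unfolding has_real_derivative_iff_has_vector_derivative[symmetric]
        by (auto intro!: derivative_eq_intros)
      show "norm (A (w n t) + B (w n (t - \<tau>))) \<le> L m" if "x < t" "t < y" for t
        using that \<open>m \<le> n\<close> \<open>- real m \<le> x\<close> \<open>y \<le> real m\<close> by (intro field_bd) auto
    qed (use False that in \<open>auto intro!: continuous_intros\<close>)
    then show ?thesis by (simp add: algebra_simps)
  qed simp
  have "convergent (\<lambda>n. w (k n) t)" for t
  proof -
    have "Cauchy (\<lambda>n. w (k n) t)"
    proof (rule metric_CauchyI)
      fix e :: real assume e: "e > 0"
      define m where "m = nat \<lceil>\<bar>t\<bar>\<rceil> + 1"
      have m: "\<bar>t\<bar> + 1 \<le> real m" unfolding m_def by linarith
      \<comment> \<open>The cap 1 keeps \<open>q\<close> inside \<open>{- real m..real m}\<close>;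
        the summand 1 in the denominator covers the case \<open>L m = 0\<close>.\<close>
      define d where "d = min 1 (e / (3 * (L m + 1)))"
      have d: "d > 0" "d \<le> 1" using e L0[of m] by (auto simp: d_def)
      have "L m * d \<le> L m * (e / (3 * (L m + 1)))"
        using L0 by (intro mult_left_mono) (auto simp: d_def)
      also have "\<dots> < e / 3" using e L0[of m] by (simp add: field_simps)
      finally have Ld: "L m * d < e / 3" .
      obtain q where q: "q \<in> \<rat>" "t - d < q" "q < t"
        using Rats_dense_in_real[of "t - d" t] d by auto
      have near: "dist (w (k n) t) (w (k n) q) < e / 3" if "m \<le> n" for n
      proof -
        have "norm (w (k n) t - w (k n) q) \<le> L m * (t - q)"
          using q d m that kn[of n] by (intro lip) linarith+
        also have "\<dots> \<le> L m * d" using q L0 by (intro mult_left_mono) auto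
        finally show ?thesis using Ld by (simp add: dist_norm)
      qed
      obtain l where "(\<lambda>n. f (k n) q) \<longlonglongrightarrow> l" using fk q by blast
      then have "(\<lambda>n. exp (\<sigma> * q) *\<^sub>R f (k n) q) \<longlonglongrightarrow> exp (\<sigma> * q) *\<^sub>R l"
        by (intro tendsto_intros)
      moreover have "\<forall>\<^sub>F n in sequentially. exp (\<sigma> * q) *\<^sub>R f (k n) q = w (k n) q"
        using eventually_ge_at_top[of m]
      proof eventually_elim
        case (elim n)
        have "\<bar>q\<bar> \<le> real (k n)" using elim kn[of n] q d m by linarith
        then show ?case by (simp add: f_def flip: exp_add)
      qed
      ultimately have "(\<lambda>n. w (k n) q) \<longlonglongrightarrow> exp (\<sigma> * q) *\<^sub>R l"
        by (rule Lim_transform_eventually)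
      then have "Cauchy (\<lambda>n. w (k n) q)" by (rule LIMSEQ_imp_Cauchy)
      then obtain N where N: "\<And>i j. N \<le> i \<Longrightarrow> N \<le> j \<Longrightarrow> dist (w (k i) q) (w (k j) q) < e / 3"
        using metric_CauchyD[of _ "e / 3"] e by (meson divide_pos_pos zero_less_numeral)
      have "dist (w (k i) t) (w (k j) t) < e" if "max m N \<le> i" "max m N \<le> j" for i j
        using near[of i] near[of j] N[of i j] that
          dist_triangle[of "w (k i) t" "w (k j) t" "w (k i) q"]
          dist_triangle[of "w (k i) q" "w (k j) t" "w (k j) q"]
          dist_commute[of "w (k j) t" "w (k j) q"] by simp
      then show "\<exists>N. \<forall>i\<ge>N. \<forall>j\<ge>N. dist (w (k i) t) (w (k j) t) < e" by blast
    qed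
    then show ?thesis by (rule Cauchy_convergent)
  qed
  then obtain g where g: "\<And>t. (\<lambda>n. w (k n) t) \<longlonglongrightarrow> g t"
    unfolding convergent_def by metis
  define h where "h t = A (g t) + B (g (t - \<tau>))" for t
  \<comment> \<open>Pointwise limits do not commute with derivatives, so the limit is taken under
    the integral, with \<open>L m\<close> as dominating constant.\<close>
  have h_int: "h integrable_on {- real m..t} \<and> g t = g (- real m) + integral {- real m..t} h"
    if t: "\<bar>t\<bar> \<le> real m" for m t
  proof -
    \<comment> \<open>Dropping the first \<open>m\<close> members leaves functions that all solve
      the equation on \<open>{- real m..real m}\<close>.\<close>
    define v where "v j = w (k (j + m))" for j
    have vk: "m \<le> k (j + m)" for j using kn[of "j + m"] by linarith
    have v_int: "((\<lambda>t. A (v j t) + B (v j (t - \<tau>))) has_integral v j t - v j (- real m)) {- real m..t}" for j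
    proof (rule fundamental_theorem_of_calculus)
      show "- real m \<le> t" using t by linarith
      have "solves_on (v j) {- real m..t}"
        unfolding v_def using vk[of j] t by (intro solves_on_subset[OF w]) auto
      then show "(v j has_vector_derivative A (v j x) + B (v j (x - \<tau>))) (at x within {- real m..t})"
        if "x \<in> {- real m..t}" for x
        using that by (simp add: solves_on_def)
    qed
    have v_lim: "(\<lambda>j. v j t) \<longlonglongrightarrow> g t" for t
      unfolding v_def using LIMSEQ_ignore_initial_segment[OF g] .
    have v_bd: "norm (A (v j x) + B (v j (x - \<tau>))) \<le> L m" if "x \<in> {- real m..t}" for j x
      unfolding v_def using that t by (intro field_bd vk) auto
    have v_h: "(\<lambda>j. A (v j x) + B (v j (x - \<tau>))) \<longlonglongrightarrow> h x" for x
      unfolding h_def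
      by (intro tendsto_add bounded_linear.tendsto[OF A v_lim] bounded_linear.tendsto[OF B v_lim])
    have "(\<lambda>t. A (v j t) + B (v j (t - \<tau>))) integrable_on {- real m..t}" for j
      using v_int by (rule has_integral_integrable)
    note dom = dominated_convergence[OF this integrable_const_ivl v_bd v_h]
    have "(\<lambda>j. v j t - v j (- real m)) \<longlonglongrightarrow> g t - g (- real m)"
      by (intro tendsto_diff v_lim)
    then have "g t - g (- real m) = integral {- real m..t} h"
      using LIMSEQ_unique[OF _ dom(2)] integral_unique[OF v_int] by auto
    then show ?thesis using dom(1) by (simp add: algebra_simps)
  qed
  have h_eq: "g (- real m) + integral {- real m..t} h = g t" if "t \<in> {- real m..real m}" for m t
    using h_int[of t m] that by (simp add: abs_le_iff)
  \<comment> \<open>Regularity is regained in two rounds: \<open>g\<close> is continuous as an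
    indefinite integral, hence \<open>h\<close> is continuous, and then the integral is
    differentiable with derivative \<open>h\<close>.\<close>
  have cont_g: "continuous_on UNIV g"
  proof (intro continuous_at_imp_continuous_on ballI)
    fix t :: real
    define m where "m = nat \<lceil>\<bar>t\<bar>\<rceil> + 1"
    have m: "\<bar>t\<bar> < real m" unfolding m_def by linarith
    have "continuous_on {- real m..real m} (\<lambda>t. g (- real m) + integral {- real m..t} h)"
      using h_int[of "real m" m] by (intro continuous_intros indefinite_integral_continuous_1) auto
    then have "continuous_on {- real m..real m} g"
      by (rule continuous_on_eq) (rule h_eq)
    then show "isCont g t"
      using m by (intro continuous_on_interior) (auto simp: abs_less_iff)
  qed
  have "solves_on g UNIV"
    unfolding solves_on_def
  proof
    fix t :: real
    define m where "m = nat \<lceil>\<bar>t\<bar>\<rceil> + 1"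
    have m: "\<bar>t\<bar> < real m" unfolding m_def by linarith
    have g\<tau>: "continuous_on UNIV (\<lambda>t. g (t - \<tau>))"
      by (intro continuous_on_compose2[OF cont_g] continuous_intros) auto
    have ch: "continuous_on UNIV h"
      unfolding h_def
      by (intro continuous_on_add bounded_linear.continuous_on[OF A cont_g] bounded_linear.continuous_on[OF B g\<tau>])
    have "((\<lambda>u. integral {- real m..u} h) has_vector_derivative h t) (at t within {- real m..real m})"
      by (rule integral_has_vector_derivative[OF continuous_on_subset[OF ch]]) (use m in auto)
    from has_vector_derivative_add[OF has_vector_derivative_const[of "g (- real m)"] this]
    have "((\<lambda>u. g (- real m) + integral {- real m..u} h) has_vector_derivative h t)
        (at t within {- real m..real m})"
      by simp
    then have "(g has_vector_derivative h t) (at t within {- real m..real m})"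
      by (rule has_vector_derivative_transform[rotated 2]) (use h_eq m in auto)
    then show "(g has_vector_derivative A (g t) + B (g (t - \<tau>))) (at t)"
      using m by (simp add: h_def at_within_Icc_at abs_less_iff)
  qed
  then show thesis using that k g by blast
qed

text \<open>Counterexamples on ever longer windows would converge to a complete solution of norm at
  least 1/2 at 0, which \<open>liouville\<close> makes vanish there. The length T is therefore not
  explicit, and it depends on \<sigma>.\<close>

lemma window_contraction:
  assumes liouville: "\<And>w. solves_on w UNIV \<Longrightarrow> (\<And>t. norm (w t) \<le> exp (\<sigma> * t)) \<Longrightarrow> w 0 = 0"
  obtains T where "T > 0"
    and "\<And>w. solves_on w {- T..T} \<Longrightarrow> (\<And>t. - T - \<tau> \<le> t \<Longrightarrow> t \<le> T \<Longrightarrow> norm (w t) \<le> exp (\<sigma> * t))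
           \<Longrightarrow> norm (w 0) \<le> 1 / 2"
proof (rule ccontr)
  assume no: "\<not> thesis"
  note goal = that
  have "\<exists>w. solves_on w {- T..T} \<and> (\<forall>t. - T - \<tau> \<le> t \<and> t \<le> T \<longrightarrow> norm (w t) \<le> exp (\<sigma> * t))
      \<and> norm (w 0) > 1 / 2" if "T > 0" for T
    using goal[OF that] no by (meson not_le)
  then have "\<exists>w. solves_on w {- real (Suc n)..real (Suc n)} \<and>
      (\<forall>t. - real (Suc n) - \<tau> \<le> t \<and> t \<le> real (Suc n) \<longrightarrow> norm (w t) \<le> exp (\<sigma> * t))
      \<and> norm (w 0) > 1 / 2" for n
    by (metis of_nat_0_less_iff zero_less_Suc)
  then obtain w where w: "\<And>n. solves_on (w n) {- real (Suc n)..real (Suc n)}"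
      and bd: "\<And>n t. - real (Suc n) - \<tau> \<le> t \<Longrightarrow> t \<le> real (Suc n) \<Longrightarrow> norm (w n t) \<le> exp (\<sigma> * t)"
      and big: "\<And>n. norm (w n 0) > 1 / 2"
    by metis
  obtain k g where k: "strict_mono (k :: nat \<Rightarrow> nat)" and g: "solves_on g UNIV"
      and lim: "\<And>t. (\<lambda>n. w (k n) t) \<longlonglongrightarrow> g t"
  proof (rule solves_on_UNIV_limit)
    show "solves_on (w n) {- real n..real n}" for n
      by (rule solves_on_subset[OF w]) auto
    show "norm (w n t) \<le> exp (\<sigma> * t)" if "- real n - \<tau> \<le> t" "t \<le> real n" for n t
      using that by (intro bd) auto
  qed blast
  have "norm (g t) \<le> exp (\<sigma> * t)" for t
  proof (rule tendsto_upperbound[OF tendsto_norm[OF lim]])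
    show "\<forall>\<^sub>F n in sequentially. norm (w (k n) t) \<le> exp (\<sigma> * t)"
      using eventually_ge_at_top[of "nat \<lceil>\<bar>t\<bar>\<rceil>"]
    proof eventually_elim
      case (elim n)
      have "\<bar>t\<bar> \<le> real (k n)" using elim seq_suble[OF k, of n] by linarith
      then show ?case using \<tau> by (intro bd) auto
    qed
  qed simp
  then have "g 0 = 0" using liouville[OF g] by blast
  moreover have "1 / 2 \<le> norm (g 0)"
    by (rule tendsto_lowerbound[OF tendsto_norm[OF lim]]) (use big in \<open>auto intro: always_eventually less_imp_le\<close>)
  ultimately show False by simp
qed

text \<open>Suppose the infimum \<sigma>0 of the rates were nonnegative. The contraction holds at
  rate \<sigma>0, but the solution is only known to be bounded at some rate \<sigma> close to it;
  the contraction has to win against this mismatch and push a rate below the infimum.\<close>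

lemma exponential_decay:
  assumes liouville: "\<And>w \<sigma>. 0 \<le> \<sigma> \<Longrightarrow> solves_on w UNIV \<Longrightarrow> (\<And>t. norm (w t) \<le> exp (\<sigma> * t)) \<Longrightarrow> w 0 = 0"
    and w: "solves_on w {0..}" and cont: "continuous_on {- \<tau>..} w"
  obtains M \<sigma> where "\<sigma> < 0" "\<And>t. - \<tau> \<le> t \<Longrightarrow> norm (w t) \<le> M * exp (\<sigma> * t)"
proof -
  define S where "S = {\<sigma>. \<exists>M. \<forall>t\<ge>-\<tau>. norm (w t) \<le> M * exp (\<sigma> * t)}"
  have "\<exists>\<sigma>\<in>S. \<sigma> < 0"
  proof (rule ccontr)
    assume "\<not> (\<exists>\<sigma>\<in>S. \<sigma> < 0)"
    then have S0: "0 \<le> \<sigma>" if "\<sigma> \<in> S" for \<sigma> using that by force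
    have ne: "S \<noteq> {}" using exponential_growth[OF w cont] unfolding S_def by blast
    have bdd: "bdd_below S" by (rule bdd_belowI[of _ 0]) (rule S0)
    define \<sigma>0 where "\<sigma>0 = Inf S"
    have "0 \<le> \<sigma>0" unfolding \<sigma>0_def using ne S0 by (rule cInf_greatest)
    then obtain T where T: "T > 0"
      and window: "\<And>w. solves_on w {- T..T} \<Longrightarrow> (\<And>t. - T - \<tau> \<le> t \<Longrightarrow> t \<le> T \<Longrightarrow> norm (w t) \<le> exp (\<sigma>0 * t))
           \<Longrightarrow> norm (w 0) \<le> 1 / 2"
      using window_contraction[of \<sigma>0] liouville[of \<sigma>0] by blast
    \<comment> \<open>A window centred at \<open>t\<close> looks back to \<open>t - P\<close>, so
      one contraction is available per time \<open>P\<close>.\<close>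
    define P where "P = T + \<tau>"
    have P: "P > 0" using T \<tau> P_def by simp
    \<comment> \<open>A factor 2/3 per time \<open>P\<close> improves the rate by
      \<open>\<eta>\<close>. The second bound in \<open>\<delta>\<close> keeps the mismatch
      exp((\<sigma> - \<sigma>0) T) at most 4/3, and 4/3 times 1/2 is 2/3; the first makes \<sigma>
      - \<eta> fall below the infimum.\<close>
    define \<eta> where "\<eta> = ln (3 / 2) / P"
    define \<delta> where "\<delta> = min \<eta> (ln (4 / 3) / T)"
    have \<delta>: "\<delta> > 0" unfolding \<delta>_def \<eta>_def using P T by simp
    obtain \<sigma> where \<sigma>: "\<sigma> \<in> S" "\<sigma> < \<sigma>0 + \<delta>"
      using cInf_less_iff[OF ne bdd, of "\<sigma>0 + \<delta>"] \<delta> \<sigma>0_def by auto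
    have \<sigma>0_le: "\<sigma>0 \<le> \<sigma>" unfolding \<sigma>0_def using bdd \<sigma>(1) by (rule cInf_lower[rotated])
    obtain M0 where M0: "\<And>t. - \<tau> \<le> t \<Longrightarrow> norm (w t) \<le> M0 * exp (\<sigma> * t)"
      using \<sigma>(1) S_def by blast
    define M where "M = \<bar>M0\<bar> + 1"
    have M: "norm (w t) \<le> M * exp (\<sigma> * t)" if "- \<tau> \<le> t" for t
      by (rule order_trans[OF M0[OF that]], rule mult_right_mono) (auto simp: M_def)
    have "(\<sigma> - \<sigma>0) * T \<le> \<delta> * T" using \<sigma>(2) T by (intro mult_right_mono) auto
    also have "\<dots> \<le> ln (4 / 3) / T * T" using T by (intro mult_right_mono) (auto simp: \<delta>_def)
    finally have c43: "exp ((\<sigma> - \<sigma>0) * T) \<le> 4 / 3"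
      using T by (subst ln_ge_iff[symmetric]) auto
    have iter: "norm (w t) \<le> M * (2 / 3) ^ n * exp (\<sigma> * t)" if "- \<tau> + real n * P \<le> t" for n t
      using that
    proof (induction n arbitrary: t)
      case 0
      then show ?case using M by simp
    next
      case (Suc n)
      \<comment> \<open>Division by \<open>C\<close> makes the shifted solution admissible at rate
        \<sigma>0: for s \<le> T, replacing \<sigma> by \<sigma>0 costs at most the last
        factor.\<close>
      define C where "C = M * (2 / 3) ^ n * exp (\<sigma> * t) * exp ((\<sigma> - \<sigma>0) * T)"
      have C: "C > 0" by (simp add: C_def M_def)
      have nP: "0 \<le> real n * P" using P by simp
      have "norm ((1 / C) *\<^sub>R w (t + 0)) \<le> 1 / 2"
      proof (rule window)
        show "solves_on (\<lambda>s. (1 / C) *\<^sub>R w (t + s)) {- T..T}"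
          by (rule solves_on_shift_scale[OF w]) (use Suc.prems nP in \<open>auto simp: P_def algebra_simps\<close>)
        fix s assume s: "- T - \<tau> \<le> s" "s \<le> T"
        have "norm (w (t + s)) \<le> M * (2 / 3) ^ n * exp (\<sigma> * (t + s))"
          by (rule Suc.IH) (use Suc.prems s in \<open>auto simp: P_def algebra_simps\<close>)
        also have "\<dots> = M * (2 / 3) ^ n * exp (\<sigma> * t) * exp ((\<sigma> - \<sigma>0) * s) * exp (\<sigma>0 * s)"
          by (simp add: algebra_simps flip: exp_add)
        also have "\<dots> \<le> C * exp (\<sigma>0 * s)"
          unfolding C_def using s \<sigma>0_le
          by (intro mult_right_mono mult_left_mono) (auto simp: M_def intro!: mult_left_mono)
        finally show "norm ((1 / C) *\<^sub>R w (t + s)) \<le> exp (\<sigma>0 * s)"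
          using C by (simp add: field_simps)
      qed
      then have "norm (w t) \<le> C / 2" using C by (simp add: field_simps)
      also have "\<dots> \<le> M * (2 / 3) ^ n * exp (\<sigma> * t) * (4 / 3) / 2"
        unfolding C_def using c43 by (intro divide_right_mono mult_left_mono) (auto simp: M_def)
      finally show ?case by (simp add: mult_ac)
    qed
    have "norm (w t) \<le> M * exp (\<eta> * (P - \<tau>)) * exp ((\<sigma> - \<eta>) * t)" if t: "- \<tau> \<le> t" for t
    proof -
      define n where "n = nat \<lfloor>(t + \<tau>) / P\<rfloor>"
      have n: "real n \<le> (t + \<tau>) / P" "(t + \<tau>) / P < real n + 1"
        using t P by (auto simp: n_def)
      then have n': "real n * P \<le> t + \<tau>" "t + \<tau> - P \<le> real n * P"
        using P by (auto simp: field_simps)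
      have "(2 / 3 :: real) ^ n = exp (- ln (3 / 2)) ^ n" by (simp add: exp_minus)
      also have "\<dots> = exp (- \<eta> * (real n * P))"
        using P by (simp add: \<eta>_def mult.commute flip: exp_of_nat_mult)
      also have "\<dots> \<le> exp (- \<eta> * (t + \<tau> - P))"
        using mult_left_mono[OF n'(2), of \<eta>] P by (simp add: \<eta>_def)
      finally have "(2 / 3) ^ n \<le> exp (- \<eta> * (t + \<tau> - P))" .
      moreover have "norm (w t) \<le> M * (2 / 3) ^ n * exp (\<sigma> * t)"
        using n' by (intro iter) linarith
      ultimately have "norm (w t) \<le> M * exp (- \<eta> * (t + \<tau> - P)) * exp (\<sigma> * t)"
        by (smt (verit, best) M_def exp_gt_zero mult_left_mono mult_right_mono)
      also have "\<dots> = M * exp (\<eta> * (P - \<tau>)) * exp ((\<sigma> - \<eta>) * t)"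
        by (simp add: algebra_simps flip: exp_add)
      finally show ?thesis .
    qed
    then have "\<sigma> - \<eta> \<in> S" unfolding S_def by blast
    then have "\<sigma>0 \<le> \<sigma> - \<eta>" unfolding \<sigma>0_def using bdd by (rule cInf_lower)
    moreover have "\<delta> \<le> \<eta>" by (simp add: \<delta>_def)
    ultimately show False using \<sigma>(2) by linarith
  qed
  then show thesis using that unfolding S_def by blast
qed

end

section \<open>Roots of the characteristic function\<close>

text \<open>Adding pi to the argument replaces (a, b) by (-a, -b), and b < 0 places the sum strictly
  between 0 and pi. The point (-a, -b) is a positive multiple of the cosine and sine that a root i
  \<omega> with c = -1 forces on \<tau>\<omega>.\<close>

lemma critical_delay_trig:
  fixes k1 k2 :: real
  defines "\<omega> \<equiv> sqrt (2 * k1)"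
  defines "a \<equiv> k1\<^sup>2 + \<omega>\<^sup>2 * (k2\<^sup>2 - k1)" and "b \<equiv> - k2 * \<omega> ^ 3"
  assumes k: "k1 > 0" "k2 > 0"
  obtains r where "r > 0" "0 < critical_delay k1 k2 * \<omega>" "critical_delay k1 k2 * \<omega> < pi"
    and "r * cos (critical_delay k1 k2 * \<omega>) = - a" "r * sin (critical_delay k1 k2 * \<omega>) = - b"
proof -
  have w: "\<omega> > 0" using k by (simp add: \<omega>_def)
  have b: "b < 0" using w k by (simp add: b_def)
  define \<theta> where "\<theta> = Arg (Complex a b)"
  have nz: "Complex a b \<noteq> 0" using b by (auto simp: complex_eq_iff)
  have cd: "critical_delay k1 k2 * \<omega> = \<theta> + pi"
    using w unfolding critical_delay_def atan2_def \<theta>_def a_def b_def \<omega>_def[symmetric] by (simp add: Let_def)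
  have "- pi < \<theta>" unfolding \<theta>_def by (rule mpi_less_Arg)
  moreover have "\<theta> < 0" unfolding \<theta>_def using b by (simp add: Arg_neg_iff)
  moreover have "norm (Complex a b) * cos \<theta> = a" "norm (Complex a b) * sin \<theta> = b"
    using Arg_eq[OF nz] unfolding \<theta>_def[symmetric]
    by (metis Re_rcis rcis_def cis_conv_exp complex.sel(1), metis Im_rcis rcis_def cis_conv_exp complex.sel(2))
  ultimately show ?thesis
    using nz by (intro that[of "norm (Complex a b)"]) (auto simp: cd)
qed

text \<open>The equation is linear in \<open>p = 1 - c * C\<close> and \<open>q = c * S\<close>, and
  determines both as functions of y. It makes q negative, which excludes c \<ge> 0 since the sine is
  nonnegative for angles below pi; for c < 0 the angle \<tau> y turns out to be too small.\<close>

lemma char_fun_imaginary_axis_nonzero: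
  fixes k1 k2 c \<tau> y :: real
  assumes k: "k1 > 0" "k2 > 0" and \<tau>: "0 \<le> \<tau>" "\<tau> < critical_delay k1 k2"
    and c: "- 1 \<le> c" "c < 1" and y: "0 \<le> y"
  shows "char_fun (of_real k1) (of_real k2) (of_real c) \<tau> (\<i> * of_real y) \<noteq> 0"
proof
  assume 0: "char_fun (of_real k1) (of_real k2) (of_real c) \<tau> (\<i> * of_real y) = 0"
  define C S where "C = cos (\<tau> * y)" and "S = sin (\<tau> * y)"
  have CS: "C\<^sup>2 + S\<^sup>2 = 1" by (simp add: C_def S_def)
  have e: "exp (- (of_real \<tau> * (\<i> * of_real y))) = Complex C (- S)"
    using cis_conv_exp[of "- (\<tau> * y)"]
    by (simp add: C_def S_def cis.code mult_ac complex_eq_iff)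
  have f: "char_fun (of_real k1) (of_real k2) (of_real c) \<tau> (\<i> * of_real y)
      = Complex (- y\<^sup>2 + k1 * (1 - c * C) - k2 * y * (c * S)) (k2 * y * (1 - c * C) + k1 * (c * S))"
    unfolding char_fun_def e by (simp add: complex_eq_iff power2_eq_square algebra_simps)
  define p q where "p = 1 - c * C" and "q = c * S"
  have eq: "k1 * p - k2 * y * q = y\<^sup>2" "k2 * y * p + k1 * q = 0"
    using 0 unfolding f p_def q_def by (simp_all add: complex_eq_iff)
  define D where "D = k1\<^sup>2 + k2\<^sup>2 * y\<^sup>2"
  have D: "D > 0" using k by (simp add: D_def add_pos_nonneg)
  \<comment> \<open>Cramer's formulas: \<open>D\<close> is the determinant of the linear system
    \<open>eq\<close>.\<close>
  have pD: "p * D = k1 * y\<^sup>2" and qD: "q * D = - k2 * y ^ 3"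
    using eq unfolding D_def by algebra+
  \<comment> \<open>The root 0 would mean c = 1.\<close>
  have "y \<noteq> 0"
  proof
    assume "y = 0"
    then have "p = 0" using pD D by simp
    then show False using \<open>y = 0\<close> c by (simp add: p_def C_def)
  qed
  then have y0: "y > 0" using y by simp
  have "(1 - p)\<^sup>2 + q\<^sup>2 = c\<^sup>2 * (C\<^sup>2 + S\<^sup>2)"
    by (simp add: p_def q_def power2_eq_square algebra_simps)
  then have c2: "(1 - p)\<^sup>2 + q\<^sup>2 = c\<^sup>2" using CS by simp
  have "c\<^sup>2 * D * D = (D - p * D)\<^sup>2 + (q * D)\<^sup>2"
    unfolding c2[symmetric] by (simp add: power2_eq_square algebra_simps)
  also have "\<dots> = (D - 2 * k1 * y\<^sup>2 + y ^ 4) * D"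
    unfolding pD qD unfolding D_def by (simp add: power2_eq_square power3_eq_cube power4_eq_xxxx algebra_simps)
  finally have c2D: "c\<^sup>2 * D = D - 2 * k1 * y\<^sup>2 + y ^ 4" using D by simp
  have "c\<^sup>2 \<le> 1" using c by (simp add: abs_square_le_1)
  then have "c\<^sup>2 * D \<le> 1 * D" using D by (intro mult_right_mono) auto
  then have "y\<^sup>2 * y\<^sup>2 \<le> 2 * k1 * y\<^sup>2" using c2D by (simp flip: power_add)
  then have y2: "y\<^sup>2 \<le> 2 * k1" using y0 by (metis mult_le_cancel_right_pos zero_less_power)
  define \<omega> where "\<omega> = sqrt (2 * k1)"
  have w: "\<omega> > 0" "\<omega>\<^sup>2 = 2 * k1" using k by (auto simp: \<omega>_def)
  have yw: "y \<le> \<omega>" unfolding \<omega>_def using y2 by (rule real_le_rsqrt)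
  define \<phi> where "\<phi> = critical_delay k1 k2 * \<omega>"
  obtain r where r: "r > 0" "0 < \<phi>" "\<phi> < pi"
      "r * cos \<phi> = - (k1\<^sup>2 + \<omega>\<^sup>2 * (k2\<^sup>2 - k1))" "r * sin \<phi> = k2 * \<omega> ^ 3"
    using critical_delay_trig[OF k] unfolding \<phi>_def \<omega>_def by auto
  have "\<tau> * y \<le> \<tau> * \<omega>" using \<tau> yw by (intro mult_left_mono)
  also have "\<dots> < \<phi>" unfolding \<phi>_def using \<tau> w by simp
  finally have ty: "\<tau> * y < \<phi>" .
  have ty0: "0 \<le> \<tau> * y" using \<tau> y by simp
  have S0: "S \<ge> 0" unfolding S_def using ty ty0 r by (intro sin_ge_zero) auto
  have "q < 0" 
  proof (rule ccontr)
    assume "\<not> q < 0"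
    then have "0 \<le> q * D" using D by simp
    moreover have "0 < k2 * y ^ 3" using k y0 by simp
    ultimately show False using qD by simp
  qed
  then have c0: "c < 0" using S0 by (metis mult_nonneg_nonneg not_less q_def)
  \<comment> \<open>Multiplied by r c D < 0, this sine becomes a polynomial in y and \<omega>. Its
    factor \<omega> - y reflects that \<phi> comes from the same formulas taken at y = \<omega>, and
    y \<le> \<omega> makes the polynomial nonnegative.\<close>
  have "0 < sin (\<phi> - \<tau> * y)" using ty ty0 r by (intro sin_gt_zero) auto
  then have "0 < sin \<phi> * C - cos \<phi> * S" by (simp add: sin_diff C_def S_def)
  then have "r * c * D * (sin \<phi> * C - cos \<phi> * S) < 0"
    by (rule mult_neg_pos[OF mult_neg_pos[OF mult_pos_neg[OF r(1) c0] D]])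
  also have "r * c * D * (sin \<phi> * C - cos \<phi> * S) = (r * sin \<phi>) * (D - p * D) - (r * cos \<phi>) * (q * D)"
    by (simp add: p_def q_def algebra_simps)
  also have "\<dots> = k2 * ((\<omega> - y) * (k1\<^sup>2 * (\<omega>\<^sup>2 + \<omega> * y + y\<^sup>2) + y\<^sup>2 * \<omega>\<^sup>2 * (k2\<^sup>2 - k1)))"
    unfolding r(4,5) pD qD unfolding D_def
    by (simp add: power2_eq_square power3_eq_cube algebra_simps)
  also have "k1\<^sup>2 * (\<omega>\<^sup>2 + \<omega> * y + y\<^sup>2) + y\<^sup>2 * \<omega>\<^sup>2 * (k2\<^sup>2 - k1)
      = k1 * (k1 * (2 * k1 - y\<^sup>2) + k1 * \<omega> * y + 2 * y\<^sup>2 * k2\<^sup>2)"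
    unfolding w(2) by (simp add: power2_eq_square algebra_simps)
  finally have neg: "k2 * ((\<omega> - y) * (k1 * (k1 * (2 * k1 - y\<^sup>2) + k1 * \<omega> * y + 2 * y\<^sup>2 * k2\<^sup>2))) < 0" .
  have "0 \<le> k2 * ((\<omega> - y) * (k1 * (k1 * (2 * k1 - y\<^sup>2) + k1 * \<omega> * y + 2 * y\<^sup>2 * k2\<^sup>2)))"
    using k y2 yw w y by (intro mult_nonneg_nonneg add_nonneg_nonneg) auto
  then show False using neg by simp
qed

text \<open>For Re s \<ge> 0 the exponential has modulus at most 1, so the bound is uniform in c and
  \<tau>. It prevents roots from entering the half-plane from infinity during the homotopy.\<close>

lemma norm_char_fun_root_le:
  assumes c: "norm c \<le> 1" and \<tau>: "0 \<le> \<tau>" and s: "0 \<le> Re s" and 0: "char_fun k1 k2 c \<tau> s = 0"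
  shows "norm s \<le> 2 * (norm k1 + norm k2) + 1"
proof (rule ccontr)
  assume "\<not> ?thesis"
  then have big: "norm s > 2 * (norm k1 + norm k2) + 1" by simp
  then have s1: "norm s \<ge> 1" by (smt (verit) norm_ge_zero)
  have "norm (c * exp (- (of_real \<tau> * s))) \<le> 1 * 1"
    unfolding norm_mult using c \<tau> s by (intro mult_mono) auto
  then have e: "norm (1 - c * exp (- (of_real \<tau> * s))) \<le> 2"
    using norm_triangle_ineq4[of 1 "c * exp (- (of_real \<tau> * s))"] by simp
  have "norm s * norm s = norm (- ((k2 * s + k1) * (1 - c * exp (- (of_real \<tau> * s)))))"
    using 0 unfolding char_fun_def by (metis add_eq_0_iff norm_mult power2_eq_square minus_minus)
  also have "\<dots> \<le> (norm k2 * norm s + norm k1) * 2"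
    unfolding norm_minus_cancel norm_mult
    by (intro mult_mono e norm_triangle_le) (auto simp: norm_mult)
  also have "\<dots> \<le> (norm k2 * norm s + norm k1 * norm s) * 2"
    using s1 mult_left_mono[OF s1, of "norm k1"] by simp
  also have "\<dots> = (2 * (norm k1 + norm k2)) * norm s" by (simp add: algebra_simps)
  also have "\<dots> < norm s * norm s" using big s1 by (intro mult_strict_right_mono) auto
  finally show False by simp
qed

lemma char_fun_closed_half_plane_nonzero:
  fixes k1 k2 c \<tau> :: real
  assumes k: "k1 > 0" "k2 > 0" and \<tau>: "0 \<le> \<tau>" "\<tau> < critical_delay k1 k2"
    and c: "- 1 \<le> c" "c < 1" and s: "0 \<le> Re s"
  shows "char_fun (of_real k1) (of_real k2) (of_real c) \<tau> s \<noteq> 0"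
proof
  define f where "f t = char_fun (of_real k1) (of_real k2) (of_real (t * c)) \<tau>" for t :: real
  define R where "R = 2 * (norm (of_real k1 :: complex) + norm (of_real k2 :: complex)) + 1"
  have tc: "- 1 \<le> t * c" "t * c < 1" "norm (of_real (t * c) :: complex) \<le> 1" if "0 \<le> t" "t \<le> 1" for t
  proof -
    have "\<bar>t * c\<bar> \<le> 1 * \<bar>c\<bar>" unfolding abs_mult using that by (intro mult_right_mono) auto
    moreover have "\<bar>c\<bar> \<le> 1" using c by simp
    moreover have "t * c < 1"
    proof (cases "c \<le> 0")
      case True
      then show ?thesis using that mult_nonneg_nonpos[of t c] by simp
    next
      case False
      then have "t * c \<le> 1 * c" using that by (intro mult_right_mono) auto
      then show ?thesis using c by simp
    qed
    ultimately show "- 1 \<le> t * c" "t * c < 1" "norm (of_real (t * c) :: complex) \<le> 1"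
      unfolding norm_of_real by auto
  qed
  have axis: "f t (\<i> * of_real y) \<noteq> 0" if "0 \<le> t" "t \<le> 1" for t y
  proof (cases "0 \<le> y")
    case True
    then show ?thesis unfolding f_def using char_fun_imaginary_axis_nonzero[OF k \<tau> tc(1,2)[OF that]] by blast
  next
    case False
    have "cnj (f t (\<i> * of_real y)) = f t (\<i> * of_real (- y))"
      unfolding f_def char_fun_def by (simp add: exp_cnj)
    moreover have "f t (\<i> * of_real (- y)) \<noteq> 0"
      unfolding f_def using char_fun_imaginary_axis_nonzero[OF k \<tau> tc(1,2)[OF that], of "- y"] False by simp
    ultimately show ?thesis by auto
  qed
  assume 0: "char_fun (of_real k1) (of_real k2) (of_real c) \<tau> s = 0"
  \<comment> \<open>The roots met during the homotopy form a compact set, so there is a smallest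
    parameter \<open>t1\<close> with a root. Before \<open>t1\<close> the half-plane is root-free,
    which is what the theorem of Hurwitz needs.\<close>
  define Q where "Q = ({0..1} \<times> (cball 0 R \<inter> {s. 0 \<le> Re s})) \<inter> {p. f (fst p) (snd p) = 0}"
  have "closed {p. f (fst p) (snd p) = 0}"
    unfolding f_def char_fun_def by (intro closed_Collect_eq continuous_intros)
  then have Q: "compact Q"
    unfolding Q_def
    by (intro compact_Int_closed compact_Times compact_Icc compact_cball closed_halfspace_Re_ge)
  have QI: "(t, s) \<in> Q" if "0 \<le> t" "t \<le> 1" "0 \<le> Re s" "f t s = 0" for t s
    using that norm_char_fun_root_le[OF tc(3)[OF that(1,2)] \<tau>(1) that(3) that(4)[unfolded f_def]]
    by (simp add: Q_def R_def)
  have "(1, s) \<in> Q" using 0 s by (intro QI) (auto simp: f_def)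
  then obtain t1 where t1: "t1 \<in> fst ` Q" "\<And>t. t \<in> fst ` Q \<Longrightarrow> t1 \<le> t"
    using compact_attains_inf[OF compact_continuous_image[OF continuous_on_fst[OF continuous_on_id] Q]]
    by (auto simp: image_iff)
  then obtain s1 where s1: "(t1, s1) \<in> Q" by force
  then have t1': "0 \<le> t1" "t1 \<le> 1" and s1': "0 \<le> Re s1" "f t1 s1 = 0" by (auto simp: Q_def)
  have "Re s1 \<noteq> 0"
  proof
    assume "Re s1 = 0"
    then have "s1 = \<i> * of_real (Im s1)" by (simp add: complex_eq_iff)
    then show False using axis[OF t1'] s1'(2) by metis
  qed
  then have s1p: "Re s1 > 0" using s1' by simp
  have "t1 \<noteq> 0"
  proof
    assume "t1 = 0"
    then have z: "s1\<^sup>2 + of_real k2 * s1 + of_real k1 = 0"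
      using s1'(2) by (simp add: f_def char_fun_def add.assoc)
    have "Im (s1\<^sup>2 + of_real k2 * s1 + of_real k1) = Im s1 * (2 * Re s1 + k2)"
      by (simp add: power2_eq_square algebra_simps)
    then have "Im s1 * (2 * Re s1 + k2) = 0" unfolding z by simp
    then have i: "Im s1 = 0" using s1p k by auto
    have "Re (s1\<^sup>2 + of_real k2 * s1 + of_real k1) = Re s1 * Re s1 + k2 * Re s1 + k1"
      using i by (simp add: power2_eq_square)
    moreover have "Re s1 * Re s1 + k2 * Re s1 + k1 > 0"
      using s1p k by (intro add_pos_pos mult_pos_pos)
    ultimately show False unfolding z by simp
  qed
  then have t1p: "t1 > 0" using t1' by simp
  define t where "t n = t1 - t1 / real (n + 2)" for n
  have t_lt: "0 \<le> t n" "t n < t1" for n using t1p by (auto simp: t_def field_simps)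
  have t_lim: "t \<longlonglongrightarrow> t1" unfolding t_def by real_asymp
  let ?S = "{s. 0 < Re s}"
  have "f t1 s1 \<noteq> 0"
  proof (rule Hurwitz_no_zeros[of ?S "\<lambda>n. f (t n)" "f t1" s1])
    show "open ?S" by (rule open_halfspace_Re_gt)
    show "topological_space_class.connected ?S" by (intro convex_connected convex_halfspace_Re_gt)
    show "f (t n) holomorphic_on ?S" for n unfolding f_def by (intro holomorphic_intros)
    show "f t1 holomorphic_on ?S" unfolding f_def by (intro holomorphic_intros)
    show "f (t n) z \<noteq> 0" if "z \<in> ?S" for n z
    proof
      assume "f (t n) z = 0"
      then have "(t n, z) \<in> Q" using that t_lt[of n] t1' by (intro QI) auto
      then have "t1 \<le> t n" using t1(2) by force
      then show False using t_lt[of n] by simp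
    qed
    \<comment> \<open>The real point R + 1 lies beyond the root bound, so the function cannot keep
      the value 0 that it takes at \<open>s1\<close>.\<close>
    show "\<not> f t1 constant_on ?S"
    proof
      assume "f t1 constant_on ?S"
      moreover have "of_real (R + 1) \<in> ?S" by (simp add: R_def add_nonneg_pos)
      ultimately have "f t1 (of_real (R + 1)) = 0"
        using s1'(2) s1p unfolding constant_on_def by (metis mem_Collect_eq)
      then have "(t1, of_real (R + 1)) \<in> Q" using t1' by (intro QI) (auto simp: R_def)
      then have "(of_real (R + 1) :: complex) \<in> cball 0 R" unfolding Q_def by blast
      then show False unfolding mem_cball_0 norm_of_real by linarith
    qed
    show "uniform_limit K (\<lambda>n. f (t n)) (f t1) sequentially" if K: "compact K" "K \<subseteq> ?S" for K
    proof (rule uniform_limitI)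
      fix e :: real assume e: "e > 0"
      define u :: "complex \<Rightarrow> complex" where "u z = of_real c * ((of_real k2 * z + of_real k1) * exp (- (of_real \<tau> * z)))" for z
      have "compact (u ` K)"
        unfolding u_def by (intro compact_continuous_image continuous_intros K)
      then obtain M where M: "\<And>z. z \<in> K \<Longrightarrow> norm (u z) \<le> M"
        using compact_imp_bounded[OF \<open>compact (u ` K)\<close>] unfolding bounded_iff by auto
      have "(\<lambda>n. \<bar>t n - t1\<bar> * M) \<longlonglongrightarrow> \<bar>t1 - t1\<bar> * M" by (intro tendsto_intros t_lim)
      then have "\<forall>\<^sub>F n in sequentially. \<bar>t n - t1\<bar> * M < e"
        using order_tendstoD(2)[of _ 0] e by simp
      then show "\<forall>\<^sub>F n in sequentially. \<forall>z\<in>K. dist (f (t n) z) (f t1 z) < e"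
      proof eventually_elim
        case (elim n)
        show ?case
        proof
          fix z assume z: "z \<in> K"
          have "f (t n) z - f t1 z = - (of_real (t n - t1) * u z)"
            unfolding f_def char_fun_def u_def by (simp add: algebra_simps)
          then have "dist (f (t n) z) (f t1 z) = \<bar>t n - t1\<bar> * norm (u z)"
            by (simp add: dist_norm norm_mult del: of_real_diff)
          also have "\<dots> \<le> \<bar>t n - t1\<bar> * M" by (intro mult_left_mono M z) auto
          finally show "dist (f (t n) z) (f t1 z) < e" using elim by simp
        qed
      qed
    qed
    show "s1 \<in> ?S" using s1p by simp
  qed
  then show False using s1'(2) by simp
qed

section \<open>Decay of a single mode\<close>

text \<open>Values are complex because the eigenfunctions are. The pair (z, v) moves in a real space
  of dimension four, and every line Re s = \<sigma> with \<sigma> \<ge> 0 is root-free, so the decay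
  principle applies.\<close>

lemma delay_mode_decay:
  fixes k1 k2 c \<tau> :: real and z v :: "real \<Rightarrow> complex"
  assumes k: "k1 > 0" "k2 > 0" and delay: "0 \<le> \<tau>" "\<tau> < critical_delay k1 k2" and c: "- 1 \<le> c" "c < 1"
    and z': "\<And>t. 0 \<le> t \<Longrightarrow> (z has_vector_derivative v t) (at t within {0..})"
    and v': "\<And>t. 0 \<le> t \<Longrightarrow> (v has_vector_derivative
        of_real c * (of_real k1 * z (t - \<tau>) + of_real k2 * v (t - \<tau>))
          - of_real k1 * z t - of_real k2 * v t) (at t within {0..})"
    and cz: "continuous_on {- \<tau>..} z" and cv: "continuous_on {- \<tau>..} v"
  shows "(z \<longlongrightarrow> 0) at_top" "(v \<longlongrightarrow> 0) at_top"
proof -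
  define A :: "complex \<times> complex \<Rightarrow> complex \<times> complex"
    where "A p = (snd p, - of_real k1 * fst p - of_real k2 * snd p)" for p
  define B :: "complex \<times> complex \<Rightarrow> complex \<times> complex"
    where "B p = (0, of_real c * (of_real k1 * fst p + of_real k2 * snd p))" for p
  have "bounded_linear A" "bounded_linear B"
    unfolding A_def B_def
    by (intro bounded_linear_Pair bounded_linear_sub bounded_linear_add bounded_linear_const_mult
        bounded_linear_fst bounded_linear_snd bounded_linear_zero)+
  then interpret linear_delay A B \<tau> using delay by (intro linear_delay.intro)
  have zero: "w 0 = 0"
    if \<sigma>: "0 \<le> \<sigma>" and w: "solves_on w UNIV" and bd: "\<And>t. norm (w t) \<le> exp (\<sigma> * t)" for w \<sigma>
  proof -
    have w': "(w has_vector_derivative A (w t) + B (w (t - \<tau>))) (at t)" for t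
      using w by (simp add: solves_on_def)
    have fst': "((\<lambda>t. fst (w t)) has_vector_derivative snd (w t)) (at t)" for t
      using bounded_linear.has_vector_derivative[OF bounded_linear_fst w'[of t]]
      by (simp add: A_def B_def)
    have snd': "((\<lambda>t. snd (w t)) has_vector_derivative
        of_real c * (of_real k1 * fst (w (t - \<tau>)) + of_real k2 * snd (w (t - \<tau>)))
          - of_real k1 * fst (w t) - of_real k2 * snd (w t)) (at t)" for t
      using bounded_linear.has_vector_derivative[OF bounded_linear_snd w'[of t]]
      by (simp add: A_def B_def algebra_simps)
    have fst0: "fst (w t0) = 0" for t0
    proof -
      \<comment> \<open>The factor restores the bound exp(\<sigma> t) after time \<open>t0\<close>
        is moved to the origin.\<close>
      define r where "r = exp (- \<sigma> * t0)"
      have "r *\<^sub>R fst (w (t0 + 0)) = 0"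
      proof (rule delay_liouville[where v = "\<lambda>t. r *\<^sub>R snd (w (t0 + t))"
            and z = "\<lambda>t. r *\<^sub>R fst (w (t0 + t))" and \<sigma> = \<sigma>])
        have chain: "((\<lambda>t. r *\<^sub>R f (t0 + t)) has_vector_derivative r *\<^sub>R f') (at t)"
          if "(f has_vector_derivative f') (at (t0 + t))" for f :: "real \<Rightarrow> complex" and f' t
        proof -
          have "((\<lambda>t. t0 + t) has_vector_derivative 1) (at t)" by (auto intro!: derivative_eq_intros)
          from has_vector_derivative_scaleR[OF DERIV_const[of r] vector_diff_chain_at[OF this that]]
          show ?thesis by (simp add: o_def)
        qed
        show "((\<lambda>t. r *\<^sub>R fst (w (t0 + t))) has_vector_derivative r *\<^sub>R snd (w (t0 + t))) (at t)" for t
          by (rule chain[OF fst'])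
        show "((\<lambda>t. r *\<^sub>R snd (w (t0 + t))) has_vector_derivative
            of_real c * (of_real k1 * r *\<^sub>R fst (w (t0 + (t - \<tau>))) + of_real k2 * r *\<^sub>R snd (w (t0 + (t - \<tau>))))
            - of_real k1 * r *\<^sub>R fst (w (t0 + t)) - of_real k2 * r *\<^sub>R snd (w (t0 + t))) (at t)" for t
          by (rule has_vector_derivative_eq_rhs[OF chain[OF snd']])
            (simp add: scaleR_conv_of_real algebra_simps)
        have e: "norm (r *\<^sub>R x) \<le> exp (\<sigma> * t)" if "norm x \<le> norm (w (t0 + t))" for x :: complex and t
        proof -
          have "norm (r *\<^sub>R x) \<le> r * exp (\<sigma> * (t0 + t))"
            using order_trans[OF that bd] by (simp add: r_def)
          also have "\<dots> = exp (\<sigma> * t)" by (simp add: r_def algebra_simps flip: exp_add)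
          finally show ?thesis .
        qed
        show "norm (r *\<^sub>R fst (w (t0 + t))) \<le> exp (\<sigma> * t)" "norm (r *\<^sub>R snd (w (t0 + t))) \<le> exp (\<sigma> * t)" for t
          by (rule e, metis norm_fst_le norm_snd_le prod.collapse)+
        show "char_fun (of_real k1) (of_real k2) (of_real c) \<tau> s \<noteq> 0" if "Re s = \<sigma>" for s
          using char_fun_closed_half_plane_nonzero[OF k delay c] that \<sigma> by simp
      qed
      then show ?thesis by (simp add: r_def)
    qed
    then have "((\<lambda>t. 0) has_vector_derivative snd (w 0)) (at 0)" using fst'[of 0] by simp
    then have "snd (w 0) = 0"
      using vector_derivative_unique_at[OF has_vector_derivative_const] by metis
    then show "w 0 = 0" using fst0[of 0] by (simp add: prod_eq_iff)
  qed
  have sol: "solves_on (\<lambda>t. (z t, v t)) {0..}"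
    unfolding solves_on_def
  proof
    fix t :: real assume "t \<in> {0..}"
    then have "0 \<le> t" by simp
    from has_vector_derivative_Pair[OF z'[OF this] v'[OF this]]
    show "((\<lambda>t. (z t, v t)) has_vector_derivative A (z t, v t) + B (z (t - \<tau>), v (t - \<tau>))) (at t within {0..})"
      by (simp add: A_def B_def algebra_simps)
  qed
  have cont: "continuous_on {- \<tau>..} (\<lambda>t. (z t, v t))" by (intro continuous_intros cz cv)
  have "\<exists>M \<sigma>. \<sigma> < 0 \<and> (\<forall>t\<ge>- \<tau>. norm (z t, v t) \<le> M * exp (\<sigma> * t))"
  proof (rule exponential_decay[OF _ sol cont])
    show "w 0 = 0" if "0 \<le> \<sigma>" "solves_on w UNIV" "\<And>t. norm (w t) \<le> exp (\<sigma> * t)" for w \<sigma>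
      using that by (rule zero)
  qed blast
  then obtain M \<sigma> where \<sigma>: "\<sigma> < 0" and M: "\<And>t. - \<tau> \<le> t \<Longrightarrow> norm (z t, v t) \<le> M * exp (\<sigma> * t)"
    by blast
  have lim: "((\<lambda>t. M * exp (\<sigma> * t)) \<longlongrightarrow> 0) at_top" using \<sigma> by real_asymp
  have "\<forall>\<^sub>F t in at_top. norm (z t) \<le> M * exp (\<sigma> * t)" "\<forall>\<^sub>F t in at_top. norm (v t) \<le> M * exp (\<sigma> * t)"
    using eventually_ge_at_top[of "- \<tau>"]
    by (eventually_elim, use order_trans[OF norm_fst_le M] order_trans[OF norm_snd_le M] in force)+
  then show "(z \<longlongrightarrow> 0) at_top" "(v \<longlongrightarrow> 0) at_top"
    using Lim_null_comparison[OF _ lim] by blast+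
qed

section \<open>The neighbour average\<close>

text \<open>Gaussian elimination, one coordinate at a time, with pivot \<open>k0\<close>. Plain
  functions on a finite set are used, so no vector space of functions on the vertices has to be set
  up.\<close>

lemma nontrivial_dependence:
  fixes g :: "'k \<Rightarrow> 'v \<Rightarrow> 'a::field"
  assumes "finite V" "finite K" "card V < card K"
  shows "\<exists>c. (\<exists>k\<in>K. c k \<noteq> 0) \<and> (\<forall>i\<in>V. (\<Sum>k\<in>K. c k * g k i) = 0)"
  using assms
proof (induction V arbitrary: K g rule: finite_induct)
  case empty
  then show ?case by (intro exI[of _ "\<lambda>_. 1"]) (auto simp: card_gt_0_iff)
next
  case (insert x V)
  show ?case
  proof (cases "\<forall>k\<in>K. g k x = 0")
    case True
    obtain c where "\<exists>k\<in>K. c k \<noteq> 0" "\<forall>i\<in>V. (\<Sum>k\<in>K. c k * g k i) = 0"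
      using insert.IH[of K g] insert.prems insert.hyps by auto
    with True show ?thesis by (intro exI[of _ c]) simp
  next
    case False
    then obtain k0 where k0: "k0 \<in> K" "g k0 x \<noteq> 0" by blast
    define K' where "K' = K - {k0}"
    define g' where "g' k i = g k i - g k x / g k0 x * g k0 i" for k i
    have "finite K'" "card V < card K'"
      using insert.prems insert.hyps k0 by (auto simp: K'_def)
    then obtain c where c: "\<exists>k\<in>K'. c k \<noteq> 0" "\<forall>i\<in>V. (\<Sum>k\<in>K'. c k * g' k i) = 0"
      using insert.IH[of K' g'] by blast
    define b where "b = c (k0 := - (\<Sum>k\<in>K'. c k * g k x / g k0 x))"
    have bsum: "(\<Sum>k\<in>K. b k * g k i) = (\<Sum>k\<in>K'. c k * g' k i)" for i
    proof -
      have "(\<Sum>k\<in>K. b k * g k i) = b k0 * g k0 i + (\<Sum>k\<in>K'. b k * g k i)"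
        unfolding K'_def using insert.prems(1) k0(1) by (rule sum.remove)
      also have "(\<Sum>k\<in>K'. b k * g k i) = (\<Sum>k\<in>K'. c k * g k i)"
        by (rule sum.cong) (auto simp: b_def K'_def)
      finally show ?thesis
        by (simp add: b_def g'_def right_diff_distrib sum_subtractf sum_distrib_right mult.assoc)
    qed
    have "g' k x = 0" for k using k0 by (simp add: g'_def)
    then have "\<forall>i\<in>insert x V. (\<Sum>k\<in>K. b k * g k i) = 0" using c(2) by (simp add: bsum)
    moreover have "\<exists>k\<in>K. b k \<noteq> 0" using c(1) by (auto simp: b_def K'_def)
    ultimately show ?thesis by blast
  qed
qed

text \<open>Connectivity enters as the statement that a function equal across every edge is
  constant, the form in which a vanishing Dirichlet form uses it. The absence of isolated vertices
  keeps the divisor of the average nonzero.\<close>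

locale neighbour_average =
  fixes V :: "'v set" and N :: "'v \<Rightarrow> 'v set"
  assumes finite_V: "finite V"
    and N_subset: "i \<in> V \<Longrightarrow> N i \<subseteq> V"
    and N_sym: "i \<in> V \<Longrightarrow> j \<in> V \<Longrightarrow> j \<in> N i \<longleftrightarrow> i \<in> N j"
    and N_nonempty: "i \<in> V \<Longrightarrow> N i \<noteq> {}"
    and N_connected: "(\<And>i j. i \<in> V \<Longrightarrow> j \<in> N i \<Longrightarrow> f i = f j) \<Longrightarrow> i \<in> V \<Longrightarrow> j \<in> V \<Longrightarrow> (f :: 'v \<Rightarrow> complex) i = f j"
begin

definition avg :: "('v \<Rightarrow> complex) \<Rightarrow> 'v \<Rightarrow> complex" where
  "avg f i = (\<Sum>j\<in>N i. f j) / of_nat (card (N i))"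

text \<open>Bilinear, not sesquilinear: it yields coordinates of the real states without conjugates,
  and \<open>cnj\<close> is written out where positivity is needed. The degree weight cancels the
  division in \<open>avg\<close>, which leaves a symmetric sum over edges.\<close>

definition pairing :: "('v \<Rightarrow> complex) \<Rightarrow> ('v \<Rightarrow> complex) \<Rightarrow> complex" where
  "pairing f g = (\<Sum>i\<in>V. of_nat (card (N i)) * f i * g i)"

definition eigenfun :: "complex \<Rightarrow> ('v \<Rightarrow> complex) \<Rightarrow> bool" where
  "eigenfun c f \<longleftrightarrow> (\<forall>i\<in>V. avg f i = c * f i)"

text \<open>Finite sums of eigenfunctions, compared only on \<open>V\<close>. As an inductive
  predicate it lets properties closed under addition be proved by induction, with no basis or index
  set.\<close>

inductive eigenspan :: "('v \<Rightarrow> complex) \<Rightarrow> bool" where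
  eigen: "eigenfun c f \<Longrightarrow> eigenspan f"
| add: "eigenspan f \<Longrightarrow> eigenspan g \<Longrightarrow> (\<And>i. i \<in> V \<Longrightarrow> h i = f i + g i) \<Longrightarrow> eigenspan h"

lemma card_N_pos: "i \<in> V \<Longrightarrow> 0 < card (N i)"
  using N_nonempty N_subset finite_V by (meson card_gt_0_iff finite_subset)

lemma avg_cong: "i \<in> V \<Longrightarrow> (\<And>j. j \<in> V \<Longrightarrow> f j = g j) \<Longrightarrow> avg f i = avg g i"
  unfolding avg_def using N_subset by (metis (no_types, lifting) subsetD sum.cong)

lemma avg_eq_0: "i \<in> V \<Longrightarrow> (\<And>j. j \<in> V \<Longrightarrow> f j = 0) \<Longrightarrow> avg f i = 0"
  using avg_cong[of i f "\<lambda>_. 0"] by (simp add: avg_def)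

lemma avg_add: "avg (\<lambda>i. f i + g i) i = avg f i + avg g i"
  by (simp add: avg_def sum.distrib add_divide_distrib)

lemma avg_mult: "avg (\<lambda>i. c * f i) i = c * avg f i"
  by (simp add: avg_def flip: sum_distrib_left)

lemma avg_diff: "avg (\<lambda>i. f i - g i) i = avg f i - avg g i"
  by (simp add: avg_def sum_subtractf diff_divide_distrib)

lemma avg_sum: "avg (\<lambda>i. \<Sum>k\<in>K. f k i) i = (\<Sum>k\<in>K. avg (f k) i)"
  unfolding avg_def by (subst sum.swap) (simp add: sum_divide_distrib)

lemma avg_cnj: "avg (\<lambda>i. cnj (f i)) i = cnj (avg f i)"
  by (simp add: avg_def)

lemma sum_edges_swap: "(\<Sum>i\<in>V. \<Sum>j\<in>N i. h i j) = (\<Sum>i\<in>V. \<Sum>j\<in>N i. h j i)"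
  for h :: "'v \<Rightarrow> 'v \<Rightarrow> 'a::comm_monoid_add"
proof -
  have "(\<Sum>i\<in>V. \<Sum>j\<in>N i. h i j) = (\<Sum>i\<in>V. \<Sum>j | j \<in> V \<and> j \<in> N i. h i j)"
    by (intro sum.cong refl) (use N_subset in blast)+
  also have "\<dots> = (\<Sum>j\<in>V. \<Sum>i | i \<in> V \<and> j \<in> N i. h i j)"
    by (rule sum.swap_restrict[OF finite_V finite_V])
  also have "\<dots> = (\<Sum>i\<in>V. \<Sum>j\<in>N i. h j i)"
    by (intro sum.cong refl) (use N_subset N_sym in blast)+
  finally show ?thesis .
qed

lemma pairing_commute: "pairing f g = pairing g f"
  by (simp add: pairing_def mult_ac)

lemma pairing_avg_left: "pairing (avg f) g = (\<Sum>i\<in>V. \<Sum>j\<in>N i. f j * g i)"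
  unfolding pairing_def avg_def
  by (intro sum.cong refl) (use card_N_pos in \<open>auto simp: sum_distrib_right\<close>)

lemma pairing_avg: "pairing (avg f) g = pairing f (avg g)"
proof -
  have "pairing (avg f) g = (\<Sum>i\<in>V. \<Sum>j\<in>N i. f i * g j)"
    unfolding pairing_avg_left by (rule sum_edges_swap)
  also have "\<dots> = pairing f (avg g)"
    unfolding pairing_commute[of f] pairing_avg_left by (simp add: mult.commute)
  finally show ?thesis .
qed

lemma pairing_cong:
  "(\<And>i. i \<in> V \<Longrightarrow> f i = f' i) \<Longrightarrow> (\<And>i. i \<in> V \<Longrightarrow> g i = g' i) \<Longrightarrow> pairing f g = pairing f' g'"
  by (simp add: pairing_def)

lemma pairing_add: "pairing (\<lambda>i. f i + g i) h = pairing f h + pairing g h"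
  by (simp add: pairing_def algebra_simps sum.distrib)

lemma pairing_diff: "pairing (\<lambda>i. f i - g i) h = pairing f h - pairing g h"
  by (simp add: pairing_def algebra_simps sum_subtractf)

lemma pairing_mult: "pairing (\<lambda>i. c * f i) h = c * pairing f h"
  by (simp add: pairing_def algebra_simps sum_distrib_left)

lemma pairing_self: "pairing f (\<lambda>i. cnj (f i)) = of_real (\<Sum>i\<in>V. real (card (N i)) * (norm (f i))\<^sup>2)"
  by (simp add: pairing_def mult.assoc flip: complex_norm_square)

lemma pairing_self_eq_0_iff: "pairing f (\<lambda>i. cnj (f i)) = 0 \<longleftrightarrow> (\<forall>i\<in>V. f i = 0)"
proof -
  have "(\<forall>i\<in>V. real (card (N i)) * (norm (f i))\<^sup>2 = 0) \<longleftrightarrow> (\<forall>i\<in>V. f i = 0)"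
    by (rule ball_cong, rule refl) (drule card_N_pos, simp)
  then show ?thesis
    unfolding pairing_self of_real_eq_0_iff by (subst sum_nonneg_eq_0_iff[OF finite_V]) simp_all
qed

section \<open>Location of the spectrum\<close>

lemma eigenvalue_real:
  assumes f: "eigenfun c f" and nz: "\<exists>i\<in>V. f i \<noteq> 0"
  shows "cnj c = c"
proof -
  let ?f = "\<lambda>i. cnj (f i)"
  have "c * pairing f ?f = pairing (avg f) ?f"
    using f by (simp add: eigenfun_def flip: pairing_mult cong: pairing_cong)
  also have "\<dots> = pairing f (avg ?f)" by (rule pairing_avg)
  also have "\<dots> = cnj c * pairing f ?f"
    using f unfolding pairing_commute[of f]
    by (simp add: eigenfun_def avg_cnj flip: pairing_mult cong: pairing_cong)
  finally show ?thesis using nz pairing_self_eq_0_iff by auto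
qed

text \<open>For e = 1 this is the Dirichlet form, for e = -1 its signless variant. Their
  nonnegativity gives c \<le> 1 and c \<ge> -1, and vanishing of the first detects the
  constants.\<close>

lemma dirichlet_form:
  assumes f: "eigenfun (of_real c) f" and e: "e = 1 \<or> e = - 1"
  shows "(\<Sum>i\<in>V. \<Sum>j\<in>N i. (norm (f i - of_real e * f j))\<^sup>2)
    = 2 * (1 - e * c) * (\<Sum>i\<in>V. real (card (N i)) * (norm (f i))\<^sup>2)"
proof -
  let ?Q = "\<Sum>i\<in>V. real (card (N i)) * (norm (f i))\<^sup>2"
  have expand: "(norm (a - of_real e * b))\<^sup>2 = (norm a)\<^sup>2 + (norm b)\<^sup>2 - 2 * e * Re (b * cnj a)" for a b :: complex
    unfolding cmod_power2 using e by (auto simp: power2_eq_square algebra_simps)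
  have "(\<Sum>i\<in>V. \<Sum>j\<in>N i. (norm (f i - of_real e * f j))\<^sup>2)
      = (\<Sum>i\<in>V. \<Sum>j\<in>N i. (norm (f i))\<^sup>2) + (\<Sum>i\<in>V. \<Sum>j\<in>N i. (norm (f j))\<^sup>2)
        - 2 * e * Re (\<Sum>i\<in>V. \<Sum>j\<in>N i. f j * cnj (f i))"
    by (simp only: expand sum.distrib sum_subtractf sum_distrib_left Re_sum)
  also have "(\<Sum>i\<in>V. \<Sum>j\<in>N i. (norm (f j))\<^sup>2) = (\<Sum>i\<in>V. \<Sum>j\<in>N i. (norm (f i))\<^sup>2)"
    by (rule sum_edges_swap)
  also have "(\<Sum>i\<in>V. \<Sum>j\<in>N i. (norm (f i))\<^sup>2) = ?Q" by simp
  also have "(\<Sum>i\<in>V. \<Sum>j\<in>N i. f j * cnj (f i)) = pairing (avg f) (\<lambda>i. cnj (f i))"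
    by (rule pairing_avg_left[symmetric])
  also have "\<dots> = of_real c * pairing f (\<lambda>i. cnj (f i))"
    using f by (simp add: eigenfun_def flip: pairing_mult cong: pairing_cong)
  also have "\<dots> = of_real (c * ?Q)" by (simp only: pairing_self of_real_mult)
  finally show ?thesis by (simp add: algebra_simps)
qed

lemma eigenvalue_bounds:
  assumes f: "eigenfun (of_real c) f" and nz: "\<exists>i\<in>V. f i \<noteq> 0"
  shows "- 1 \<le> c" "c \<le> 1"
proof -
  let ?Q = "\<Sum>i\<in>V. real (card (N i)) * (norm (f i))\<^sup>2"
  have "?Q \<noteq> 0" using nz pairing_self_eq_0_iff[of f] unfolding pairing_self of_real_eq_0_iff by blast
  then have Q: "?Q > 0" by (simp add: less_le sum_nonneg)
  have "0 \<le> 2 * (1 - e * c) * ?Q" if "e = 1 \<or> e = - 1" for e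
    unfolding dirichlet_form[OF f that, symmetric] by (intro sum_nonneg) simp
  from this[of 1] this[of "- 1"] Q show "- 1 \<le> c" "c \<le> 1" by (auto simp: zero_le_mult_iff)
qed

lemma eigenfun_1_constant:
  assumes f: "eigenfun 1 f" and "i \<in> V" "j \<in> V"
  shows "f i = f j"
proof (rule N_connected[OF _ assms(2,3)])
  have "(\<Sum>i\<in>V. \<Sum>j\<in>N i. (norm (f i - of_real 1 * f j))\<^sup>2) = 0"
    using dirichlet_form[of 1 f 1] f by simp
  then have "\<forall>i\<in>V. (\<Sum>j\<in>N i. (norm (f i - of_real 1 * f j))\<^sup>2) = 0"
    by (subst (asm) sum_nonneg_eq_0_iff[OF finite_V]) (auto intro: sum_nonneg)
  then show "f i = f j" if "i \<in> V" "j \<in> N i" for i j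
    using that finite_subset[OF N_subset finite_V] by (auto simp: sum_nonneg_eq_0_iff)
qed

section \<open>Diagonalisation of the neighbour average\<close>

lemma eigenfun_mult: "eigenfun c f \<Longrightarrow> eigenfun c (\<lambda>i. a * f i)"
  by (simp add: eigenfun_def avg_mult)

lemma eigenspan_mult: "eigenspan f \<Longrightarrow> eigenspan (\<lambda>i. a * f i)"
proof (induction rule: eigenspan.induct)
  case (eigen c f)
  then show ?case by (intro eigenspan.eigen eigenfun_mult)
next
  case (add f g h)
  show ?case
    by (rule eigenspan.add[OF add.IH]) (simp add: add.hyps algebra_simps)
qed

text \<open>On an eigenfunction with eigenvalue d \<noteq> c the map avg - c is multiplication by d
  - c and can be inverted; an eigenfunction for c itself goes into \<open>h\<close>.\<close>

lemma eigenspan_decompose: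
  "eigenspan f \<Longrightarrow> \<exists>g h. eigenspan g \<and> eigenfun c h \<and> (\<forall>i\<in>V. f i = avg g i - c * g i + h i)"
proof (induction rule: eigenspan.induct)
  case (eigen d f)
  show ?case
  proof (cases "d = c")
    case True
    have "eigenspan (\<lambda>_. 0)" by (rule eigenspan.eigen[of 0]) (simp add: eigenfun_def avg_def)
    then show ?thesis using eigen True
      by (intro exI[of _ "\<lambda>_. 0"] exI[of _ f]) (simp add: avg_def)
  next
    case False
    have g: "eigenfun d (\<lambda>i. 1 / (d - c) * f i)" by (rule eigenfun_mult[OF eigen])
    then have "\<forall>i\<in>V. f i = avg (\<lambda>i. 1 / (d - c) * f i) i - c * (1 / (d - c) * f i) + 0"
      using False unfolding eigenfun_def by (auto simp: field_simps)
    moreover have "eigenfun c (\<lambda>_. 0)" by (simp add: eigenfun_def avg_def)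
    ultimately show ?thesis using eigenspan.eigen[OF g] by blast
  qed
next
  case (add f1 f2 f)
  obtain g1 h1 g2 h2 where 1: "eigenspan g1" "eigenfun c h1" "\<forall>i\<in>V. f1 i = avg g1 i - c * g1 i + h1 i"
    and 2: "eigenspan g2" "eigenfun c h2" "\<forall>i\<in>V. f2 i = avg g2 i - c * g2 i + h2 i"
    using add.IH by blast
  have "eigenspan (\<lambda>i. g1 i + g2 i)" by (rule eigenspan.add[OF 1(1) 2(1)]) simp
  moreover have "eigenfun c (\<lambda>i. h1 i + h2 i)"
    using 1(2) 2(2) by (simp add: eigenfun_def avg_add algebra_simps)
  moreover have "\<forall>i\<in>V. f i = avg (\<lambda>i. g1 i + g2 i) i - c * (g1 i + g2 i) + (h1 i + h2 i)"
    using 1(3) 2(3) add.hyps by (simp add: avg_add algebra_simps)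
  ultimately show ?case by blast
qed

text \<open>This is where self-adjointness excludes Jordan blocks.\<close>

lemma eigenspan_lift:
  assumes "eigenspan (\<lambda>i. avg f i - c * f i)"
  shows "eigenspan f"
proof -
  obtain g h where g: "eigenspan g" and h: "eigenfun c h"
    and eq: "\<forall>i\<in>V. avg f i - c * f i = avg g i - c * g i + h i"
    using eigenspan_decompose[OF assms] by blast
  define u where "u i = f i - g i" for i
  have u: "avg u i - c * u i = h i" if "i \<in> V" for i
    using eq that unfolding u_def by (simp add: avg_diff algebra_simps)
  have "\<forall>i\<in>V. h i = 0"
  proof (rule ccontr)
    assume nz: "\<not> (\<forall>i\<in>V. h i = 0)"
    let ?h = "\<lambda>i. cnj (h i)"
    have "pairing h ?h = pairing (\<lambda>i. avg u i - c * u i) ?h"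
      by (rule pairing_cong) (simp_all add: u)
    also have "\<dots> = pairing u (avg ?h) - c * pairing u ?h"
      by (simp add: pairing_diff pairing_mult pairing_avg)
    also have "pairing u (avg ?h) = pairing u (\<lambda>i. cnj c * cnj (h i))"
      using h by (intro pairing_cong) (simp_all add: eigenfun_def avg_cnj)
    also have "\<dots> = c * pairing u ?h"
      using eigenvalue_real[OF h] nz unfolding pairing_commute[of u] by (simp add: pairing_mult)
    finally show False using nz pairing_self_eq_0_iff by simp
  qed
  then have "eigenfun c u" using u by (simp add: eigenfun_def)
  then show ?thesis
    using eigenspan.add[OF g eigenspan.eigen] by (simp add: u_def)
qed

definition avg_poly :: "complex poly \<Rightarrow> ('v \<Rightarrow> complex) \<Rightarrow> 'v \<Rightarrow> complex" where
  "avg_poly p f i = (\<Sum>k\<le>degree p. coeff p k * (avg ^^ k) f i)"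

lemma avg_poly_bound: "degree p \<le> n \<Longrightarrow> avg_poly p f i = (\<Sum>k\<le>n. coeff p k * (avg ^^ k) f i)"
  unfolding avg_poly_def by (rule sum.mono_neutral_left) (auto simp: coeff_eq_0)

lemma avg_poly_linear_factor:
  "avg_poly ([:- c, 1:] * q) f i = avg (avg_poly q f) i - c * avg_poly q f i"
proof -
  let ?n = "degree q"
  have "avg_poly ([:- c, 1:] * q) f i
      = (\<Sum>k\<le>Suc ?n. coeff ([:- c, 1:] * q) k * (avg ^^ k) f i)"
    by (rule avg_poly_bound) (metis degree_mult_le degree_pCons_eq_if one_neq_zero add.commute
        degree_0 One_nat_def Suc_eq_plus1 pCons_eq_0_iff)
  also have "\<dots> = (\<Sum>k\<le>Suc ?n. coeff (pCons 0 q) k * (avg ^^ k) f i)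
      - c * (\<Sum>k\<le>Suc ?n. coeff q k * (avg ^^ k) f i)"
    by (simp add: algebra_simps sum_subtractf sum_distrib_left del: sum.atMost_Suc)
  also have "(\<Sum>k\<le>Suc ?n. coeff q k * (avg ^^ k) f i) = avg_poly q f i"
    by (rule avg_poly_bound[symmetric]) simp
  also have "(\<Sum>k\<le>Suc ?n. coeff (pCons 0 q) k * (avg ^^ k) f i)
      = (\<Sum>k\<le>?n. coeff q k * avg ((avg ^^ k) f) i)"
    by (subst sum.atMost_Suc_shift) simp
  also have "\<dots> = avg (avg_poly q f) i"
    unfolding avg_poly_def[abs_def] avg_sum avg_mult ..
  finally show ?thesis .
qed

text \<open>Over the complex numbers \<open>p\<close> splits, and \<open>eigenspan_lift\<close>
  removes one linear factor at a time.\<close>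

lemma eigenspan_avg_poly: "p \<noteq> 0 \<Longrightarrow> eigenspan (avg_poly p f) \<Longrightarrow> eigenspan f"
proof (induction "degree p" arbitrary: p)
  case 0
  then obtain a where p: "p = [:a:]" "a \<noteq> 0" by (metis degree_eq_zeroE pCons_0_0)
  have "eigenspan (\<lambda>i. 1 / a * avg_poly p f i)" by (rule eigenspan_mult[OF 0(3)])
  then show ?case using p by (simp add: avg_poly_def)
next
  case (Suc n)
  then obtain c where "poly p c = 0"
    using Fundamental_Theorem_Algebra.fundamental_theorem_of_algebra[of p] by (metis constant_degree nat.distinct(1))
  then obtain q where p: "p = [:- c, 1:] * q" using poly_eq_0_iff_dvd by blast
  then have q: "q \<noteq> 0" using Suc.prems by auto
  have "degree p = degree [:- c, 1:] + degree q" unfolding p using q by (intro degree_mult_eq) auto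
  then have "n = degree q" using Suc.hyps(2) by simp
  moreover have "eigenspan (\<lambda>i. avg (avg_poly q f) i - c * avg_poly q f i)"
    using Suc.prems(2) unfolding p avg_poly_linear_factor[abs_def] .
  ultimately show ?case using Suc.hyps(1)[OF _ q] eigenspan_lift by blast
qed

text \<open>The iterates of the average on \<open>f\<close>, one more than there are vertices, are
  dependent on \<open>V\<close>, so a nonzero polynomial in the average annihilates
  \<open>f\<close>. This takes the place of the spectral theorem for symmetric matrices.\<close>

lemma eigenspan_all: "eigenspan f"
proof -
  obtain c where c: "\<exists>k\<in>{..card V}. c k \<noteq> 0" "\<forall>i\<in>V. (\<Sum>k\<le>card V. c k * (avg ^^ k) f i) = 0"
    using nontrivial_dependence[OF finite_V, of "{..card V}" "\<lambda>k. (avg ^^ k) f"] by auto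
  define p where "p = (\<Sum>k\<le>card V. monom (c k) k)"
  have co: "coeff p k = (if k \<le> card V then c k else 0)" for k
    by (simp add: p_def coeff_sum)
  have "p \<noteq> 0" using c(1) co by (metis atMost_iff coeff_0)
  moreover have "degree p \<le> card V" by (rule degree_le) (simp add: co)
  then have "avg_poly p f i = 0" if "i \<in> V" for i
    using c(2) that by (simp add: avg_poly_bound co)
  then have "eigenspan (avg_poly p f)"
    by (intro eigenspan.eigen[of 0]) (simp add: eigenfun_def avg_eq_0)
  ultimately show ?thesis by (rule eigenspan_avg_poly)
qed

text \<open>Splitting at the eigenvalue 1 gives f = (avg g - g) + h with h constant, and zero mean
  forces h = 0. The map avg - 1 erases the parts of \<open>g\<close> with eigenvalue 1 and
  multiplies the others by d - 1, so only modes with c < 1 remain.\<close>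

lemma zero_mean_induct:
  assumes mean: "pairing f (\<lambda>_. 1) = 0"
    and add: "\<And>f g h. P f \<Longrightarrow> P g \<Longrightarrow> (\<And>i. i \<in> V \<Longrightarrow> h i = f i + g i) \<Longrightarrow> P h"
    and eigen: "\<And>c f. - 1 \<le> c \<Longrightarrow> c < 1 \<Longrightarrow> eigenfun (of_real c) f \<Longrightarrow> P f"
  shows "P f"
proof -
  have zero: "P g" if "\<And>i. i \<in> V \<Longrightarrow> g i = 0" for g
    using that by (intro eigen[of 0]) (auto simp: eigenfun_def avg_eq_0)
  have cong: "P g" if "P f" "\<And>i. i \<in> V \<Longrightarrow> g i = f i" for f g
    using add[OF that(1) zero[of "\<lambda>_. 0"]] that(2) by simp
  obtain g h where h: "eigenfun 1 h" and eq: "\<And>i. i \<in> V \<Longrightarrow> f i = avg g i - 1 * g i + h i"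
    using eigenspan_decompose[OF eigenspan_all, of 1 f] by blast
  have "pairing f (\<lambda>_. 1) = pairing (\<lambda>i. (avg g i - g i) + h i) (\<lambda>_. 1)"
    by (rule pairing_cong) (simp_all add: eq)
  also have "\<dots> = pairing g (avg (\<lambda>_. 1)) - pairing g (\<lambda>_. 1) + pairing h (\<lambda>_. 1)"
    by (simp add: pairing_add pairing_diff pairing_avg)
  also have "pairing g (avg (\<lambda>_. 1)) = pairing g (\<lambda>_. 1)"
    by (rule pairing_cong) (use card_N_pos in \<open>auto simp: avg_def\<close>)
  finally have h0: "pairing h (\<lambda>_. 1) = 0" using mean by simp
  have "h i = 0" if i: "i \<in> V" for i
  proof -
    have "pairing h (\<lambda>_. 1) = pairing (\<lambda>_. h i * 1) (\<lambda>_. 1)"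
      using eigenfun_1_constant[OF h _ i] by (intro pairing_cong) auto
    also have "\<dots> = h i * of_nat (\<Sum>i\<in>V. card (N i))" by (simp only: pairing_mult) (simp add: pairing_def)
    finally have "h i * of_nat (\<Sum>i\<in>V. card (N i)) = 0" using h0 by simp
    moreover have "(\<Sum>i\<in>V. card (N i)) \<noteq> 0"
      using i card_N_pos finite_V by (metis less_irrefl sum_eq_0_iff)
    ultimately show ?thesis by (metis mult_eq_0_iff of_nat_eq_0_iff)
  qed
  then have f: "f i = avg g i - g i" if "i \<in> V" for i using eq that by simp
  have "eigenspan g" by (rule eigenspan_all)
  then have "P (\<lambda>i. avg g i - g i)"
  proof (induction rule: eigenspan.induct)
    case (eigen d g)
    show ?case
    proof (cases "d = 1 \<or> (\<forall>i\<in>V. g i = 0)")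
      case True
      then show ?thesis using eigen by (intro zero) (auto simp: eigenfun_def)
    next
      case False
      then have nz: "\<exists>i\<in>V. g i \<noteq> 0" by blast
      obtain c where c: "d = of_real c"
        using eigenvalue_real[OF eigen nz] by (metis Reals_cases Reals_cnj_iff)
      have "- 1 \<le> c" "c < 1"
        using eigenvalue_bounds[OF eigen[unfolded c] nz] False c by (auto simp: less_le)
      then have "P (\<lambda>i. (d - 1) * g i)"
        using assms(3) eigenfun_mult[OF eigen] c by blast
      then show ?thesis
        by (rule cong) (use eigen in \<open>auto simp: eigenfun_def algebra_simps\<close>)
    qed
  next
    case (add g1 g2 g)
    have "avg g i - g i = avg g1 i - g1 i + (avg g2 i - g2 i)" if "i \<in> V" for i
      using add.hyps(3) that by (simp add: avg_cong[of i g "\<lambda>i. g1 i + g2 i"] avg_add)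
    then show ?case by (rule assms(2)[OF add.IH])
  qed
  then show ?thesis by (rule cong) (rule f)
qed

end

section \<open>From graphs to consensus\<close>

lemma neighbour_average_graph:
  assumes G: "graph G" and conn: "Digraph_Component.connected G" and card: "card (verts G) \<ge> 2"
  shows "neighbour_average (verts G) (neighbours G)"
proof -
  interpret graph G by (rule G)
  have sc: "strongly_connected G" by (rule symmetric_connected_imp_strongly_connected[OF sym_arcs conn])
  show ?thesis
  proof
    show "finite (verts G)" by simp
    show "neighbours G i \<subseteq> verts G" for i
      unfolding neighbours_def using adj_in_verts by blast
    show "j \<in> neighbours G i \<longleftrightarrow> i \<in> neighbours G j" for i j
      unfolding neighbours_def using graph_symmetric by blast
    show "neighbours G i \<noteq> {}" if i: "i \<in> verts G" for i
    proof -
      \<comment> \<open>A second vertex gives a path somewhere to go, and its first arc ends in a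
        neighbour of \<open>i\<close>.\<close>
      have "\<not> verts G \<subseteq> {i}" using card card_mono[of "{i}" "verts G"] by auto
      then obtain j where j: "j \<in> verts G" "j \<noteq> i" by blast
      then have "i \<rightarrow>\<^sup>*\<^bsub>G\<^esub> j" using sc i by blast
      then show ?thesis using j(2) unfolding neighbours_def
        by (cases rule: converse_reachable_cases) auto
    qed
    fix f :: "'a \<Rightarrow> complex" and i j
    assume f: "\<And>i j. i \<in> verts G \<Longrightarrow> j \<in> neighbours G i \<Longrightarrow> f i = f j"
      and "i \<in> verts G" "j \<in> verts G"
    then have "i \<rightarrow>\<^sup>*\<^bsub>G\<^esub> j" using sc by blast
    then show "f i = f j"
    proof (induction rule: converse_reachable_induct)
      case base
      show ?case ..
    next
      case (step u w)
      have "f u = f w" using step.hyps(1) by (intro f) (auto simp: neighbours_def adj_in_verts)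
      then show ?case using step.IH by simp
    qed
  qed
qed

context neighbour_average
begin

lemma pairing_has_vector_derivative:
  assumes "\<And>i. i \<in> V \<Longrightarrow> (x i has_real_derivative x' i) (at t within S)"
  shows "((\<lambda>t. pairing f (\<lambda>i. of_real (x i t))) has_vector_derivative pairing f (\<lambda>i. of_real (x' i)))
    (at t within S)"
  unfolding pairing_def
  by (intro has_vector_derivative_sum has_vector_derivative_mult_right has_vector_derivative_of_real assms)

lemma pairing_eigenfun_avg:
  assumes "eigenfun c f"
  shows "pairing f (avg g) = c * pairing f g"
proof -
  have "pairing f (avg g) = pairing (\<lambda>i. c * f i) g"
    unfolding pairing_avg[symmetric] using assms by (intro pairing_cong) (auto simp: eigenfun_def)
  then show ?thesis by (simp add: pairing_mult)
qed

text \<open>Dividing by the degree cancels the weight, so evaluation at a vertex is itself a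
  pairing.\<close>

lemma pairing_delta:
  assumes "i \<in> V"
  shows "pairing (\<lambda>l. if l = i then 1 / of_nat (card (N i)) else 0) g = g i"
proof -
  have "pairing (\<lambda>l. if l = i then 1 / of_nat (card (N i)) else 0) g
      = (\<Sum>l\<in>V. if l = i then g i else 0)"
    unfolding pairing_def using card_N_pos[OF assms] by (intro sum.cong) auto
  then show ?thesis using assms finite_V by simp
qed

end

theorem mainTheorem3:
  fixes k1 k2 \<tau> :: real and n :: nat and G :: "('v, 'e) pre_digraph"
  assumes "k1 > 0" and "k2 > 0"
    and "0 \<le> \<tau>" and "\<tau> < critical_delay k1 k2"
    and "n \<ge> 2" and "graph G" and "Digraph_Component.connected G" and "card (verts G) = n"
  shows "reach_consensus G k1 k2 \<tau>"
  unfolding reach_consensus_def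
proof (intro allI impI ballI)
  fix x v i j
  assume traj: "trajectory G k1 k2 \<tau> x v" and i: "i \<in> verts G" and j: "j \<in> verts G"
  interpret neighbour_average "verts G" "neighbours G"
    using neighbour_average_graph assms by blast
  have x': "(x l has_real_derivative v l t) (at t within {- \<tau>..})" if "l \<in> verts G" "- \<tau> \<le> t" for l t
    using traj that unfolding trajectory_def by blast
  have cv: "continuous_on {- \<tau>..} (v l)" if "l \<in> verts G" for l
    using traj that unfolding trajectory_def by blast
  have v': "(v l has_real_derivative protocol G k1 k2 \<tau> x v l t) (at t within {0..})"
    if "l \<in> verts G" "0 \<le> t" for l t
    using traj that unfolding trajectory_def by blast
  have cx: "continuous_on {- \<tau>..} (x l)" if "l \<in> verts G" for l
    using x'[OF that] by (intro DERIV_continuous_on) auto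
  define X where "X f t = pairing f (\<lambda>l. of_real (x l t))" for f t
  define W where "W f t = pairing f (\<lambda>l. of_real (v l t))" for f t
  \<comment> \<open>Represents the difference between agents \<open>i\<close> and \<open>j\<close>
    as a pairing. Its pairing with the constant 1 is 1 - 1 = 0, so the eigenvalue 1 does not
    occur.\<close>
  define f where "f l = (if l = i then 1 / of_nat (card (neighbours G i)) else 0)
    - (if l = j then 1 / of_nat (card (neighbours G j)) else (0::complex))" for l
  have pairing_f: "pairing f g = g i - g j" for g
    unfolding f_def by (simp only: pairing_diff pairing_delta i j)
  have "(X f \<longlongrightarrow> 0) at_top \<and> (W f \<longlongrightarrow> 0) at_top"
  proof (rule zero_mean_induct[where P = "\<lambda>f. (X f \<longlongrightarrow> 0) at_top \<and> (W f \<longlongrightarrow> 0) at_top"])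
    show "pairing f (\<lambda>_. 1) = 0" by (simp add: pairing_f)
  next
    fix f g h :: "'v \<Rightarrow> complex"
    assume f: "(X f \<longlongrightarrow> 0) at_top \<and> (W f \<longlongrightarrow> 0) at_top"
      and g: "(X g \<longlongrightarrow> 0) at_top \<and> (W g \<longlongrightarrow> 0) at_top"
      and h: "\<And>i. i \<in> verts G \<Longrightarrow> h i = f i + g i"
    have "pairing h u = pairing f u + pairing g u" for u
      unfolding pairing_add[symmetric] by (rule pairing_cong) (auto simp: h)
    then have "X h = (\<lambda>t. X f t + X g t)" "W h = (\<lambda>t. W f t + W g t)"
      by (auto simp: X_def W_def)
    then show "(X h \<longlongrightarrow> 0) at_top \<and> (W h \<longlongrightarrow> 0) at_top"
      using tendsto_add[of "X f" 0 _ "X g" 0] tendsto_add[of "W f" 0 _ "W g" 0] f g by simp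
  next
    fix c f assume c: "- 1 \<le> c" "c < 1" and f: "eigenfun (of_real c) f"
    have X': "(X f has_vector_derivative W f t) (at t within {0..})" if "0 \<le> t" for t
      unfolding X_def W_def using that assms(3)
      by (intro pairing_has_vector_derivative DERIV_subset[OF x']) auto
    have W': "(W f has_vector_derivative
        of_real c * (of_real k1 * X f (t - \<tau>) + of_real k2 * W f (t - \<tau>))
          - of_real k1 * X f t - of_real k2 * W f t) (at t within {0..})" if "0 \<le> t" for t
    proof -
      let ?x = "\<lambda>t l. complex_of_real (x l t)" and ?v = "\<lambda>t l. complex_of_real (v l t)"
      have W0: "(W f has_vector_derivative pairing f (\<lambda>l. of_real (protocol G k1 k2 \<tau> x v l t)))
          (at t within {0..})"
        unfolding W_def by (intro pairing_has_vector_derivative v' that)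
      have "pairing f (\<lambda>l. of_real (protocol G k1 k2 \<tau> x v l t))
          = pairing f (\<lambda>l. of_real k1 * avg (?x (t - \<tau>)) l + of_real k2 * avg (?v (t - \<tau>)) l
              - of_real k1 * ?x t l - of_real k2 * ?v t l)"
        by (rule pairing_cong)
          (simp_all add: protocol_def avg_def sum_divide_distrib algebra_simps)
      also have "\<dots> = of_real k1 * pairing f (avg (?x (t - \<tau>))) + of_real k2 * pairing f (avg (?v (t - \<tau>)))
              - of_real k1 * X f t - of_real k2 * W f t"
        unfolding X_def W_def pairing_commute[of f] pairing_diff pairing_add pairing_mult ..
      also have "\<dots> = of_real c * (of_real k1 * X f (t - \<tau>) + of_real k2 * W f (t - \<tau>))
          - of_real k1 * X f t - of_real k2 * W f t"
        unfolding pairing_eigenfun_avg[OF f] by (simp add: X_def W_def algebra_simps)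
      finally show ?thesis by (rule has_vector_derivative_eq_rhs[OF W0])
    qed
    have "continuous_on {- \<tau>..} (X f)" "continuous_on {- \<tau>..} (W f)"
      unfolding X_def W_def pairing_def by (intro continuous_intros cx cv; assumption)+
    then show "(X f \<longlongrightarrow> 0) at_top \<and> (W f \<longlongrightarrow> 0) at_top"
      using delay_mode_decay[OF assms(1-4) c X' W'] by blast
  qed
  then have "((\<lambda>t. complex_of_real (x i t - x j t)) \<longlongrightarrow> of_real 0) at_top"
    "((\<lambda>t. complex_of_real (v i t - v j t)) \<longlongrightarrow> of_real 0) at_top"
    by (simp_all add: X_def[abs_def] W_def[abs_def] pairing_f)
  then show "((\<lambda>t. x i t - x j t) \<longlongrightarrow> 0) at_top \<and> ((\<lambda>t. v i t - v j t) \<longlongrightarrow> 0) at_top"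
    unfolding tendsto_of_real_iff by blast
qed

end
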